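(* Let $n \geq 4$ and let $M$ be a monomial in $n$ variables $x_1,\dotsc,x_n$ (not necessarily involving every variable), and let $d = \deg M > 1$. Then $r(M) < r_{\mathrm{gen}}(n,d)$.
   Context: All polynomials have complex coefficients. For a homogeneous polynomial $F(x_1,\dotsc,x_n)$ of degree $d$, the Waring rank $r(F)$ is the least number $r$ of terms needed to write $F = c_1 \ell_1^d + \dotsb + c_r \ell_r^d$ with $c_i \in \mathbb{C}$ and $\ell_i$ homogeneous linear forms in $x_1,\dotsc,x_n$. The generic Waring rank $r_{\mathrm{gen}}(n,d)$ is the value of $r(F)$ that holds for all $F$ in a dense Zariski open subset of the space of homogeneous polynomials of degree $d$ in $n$ variables. By the Alexander--Hirschowitz theorem, $r_{\mathrm{gen}}(n,d) = \left\lceil \frac{1}{n} \binom{d+n-1}{n-1} \right\rceil$, except that $r_{\mathrm{gen}}(n,2)=n$, $r_{\mathrm{gen}}(3,4)=6$, $r_{\mathrm{gen}}(4,4)=10$, $r_{\mathrm{gen}}(5,3)=8$, and $r_{\mathrm{gen}}(5,4)=15$. *)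

theory Defs
  imports "HOL-Library.Poly_Mapping" "HOL-Analysis.Analysis"
begin

text \<open>Monomials in variables \<open>x\<^sub>v\<close> are exponent vectors of finite support; polynomials are finitely
  supported coefficient functions on monomials, with the convolution product of
  \<^theory>\<open>HOL-Library.Poly_Mapping\<close>.\<close>

type_synonym 'v monom = "'v \<Rightarrow>\<^sub>0 nat"
type_synonym 'v cpoly = "'v monom \<Rightarrow>\<^sub>0 complex"

definition mdeg :: "'v monom \<Rightarrow> nat" where
  "mdeg m = (\<Sum>v\<in>Poly_Mapping.keys m. Poly_Mapping.lookup m v)"

definition eval_monom :: "'v monom \<Rightarrow> ('v \<Rightarrow> complex) \<Rightarrow> complex" where
  "eval_monom m x = (\<Prod>v\<in>Poly_Mapping.keys m. x v ^ Poly_Mapping.lookup m v)"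

definition eval_poly :: "'v cpoly \<Rightarrow> ('v \<Rightarrow> complex) \<Rightarrow> complex" where
  "eval_poly P x = (\<Sum>m\<in>Poly_Mapping.keys P. Poly_Mapping.lookup P m * eval_monom m x)"

text \<open>Homogeneous polynomials of degree \<open>d\<close> in \<open>x\<^sub>1, \<dots>, x\<^sub>n\<close>, including the zero polynomial.\<close>

definition forms :: "nat \<Rightarrow> nat \<Rightarrow> nat cpoly set" where
  "forms n d = {F. \<forall>m\<in>Poly_Mapping.keys F. Poly_Mapping.keys m \<subseteq> {1..n} \<and> mdeg m = d}"

text \<open>The degree \<open>d\<close> is an explicit argument, and the value is meant for \<open>F \<in> forms n d\<close>.
  The factor \<open>single 0 c\<close> is the constant polynomial \<open>c\<close>.\<close>

definition waring_rank :: "nat \<Rightarrow> nat \<Rightarrow> nat cpoly \<Rightarrow> nat" where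
  "waring_rank n d F =
     (LEAST r. \<exists>c l. (\<forall>i<r. l i \<in> forms n 1) \<and>
                     F = (\<Sum>i<r. Poly_Mapping.single 0 (c i) * l i ^ d))"

text \<open>The Zariski topology on the affine space \<open>forms n d\<close>, whose coordinates are the coefficients:
  the closed sets are the common zero loci of sets of polynomials in the coefficients, so the
  open sets are their complements. The variables of \<open>P\<close> are indexed by all monomials; those not of
  degree \<open>d\<close> in \<open>x\<^sub>1, \<dots>, x\<^sub>n\<close> are evaluated at zero.\<close>

definition zariski :: "nat \<Rightarrow> nat \<Rightarrow> nat cpoly topology" where
  "zariski n d = topology (\<lambda>U. \<exists>S :: nat monom cpoly set.
     U = forms n d - {F \<in> forms n d. \<forall>P\<in>S. eval_poly P (Poly_Mapping.lookup F) = 0})"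

definition generic_waring_rank :: "nat \<Rightarrow> nat \<Rightarrow> nat" where
  "generic_waring_rank n d =
     (THE r. \<exists>U. openin (zariski n d) U \<and> zariski n d closure_of U = topspace (zariski n d) \<and>
                 (\<forall>F\<in>U. waring_rank n d F = r))"

lemma eval_monom_superset:
  assumes "finite A" "Poly_Mapping.keys m \<subseteq> A"
  shows "eval_monom m x = (\<Prod>v\<in>A. x v ^ Poly_Mapping.lookup m v)"
  unfolding eval_monom_def
  by (rule prod.mono_neutral_left) (use assms in \<open>auto simp: in_keys_iff\<close>)

lemma eval_monom_zero [simp]: "eval_monom 0 x = 1"
  by (simp add: eval_monom_def)

lemma eval_monom_add: "eval_monom (m + m') x = eval_monom m x * eval_monom m' x"
proof -
  let ?A = "Poly_Mapping.keys m \<union> Poly_Mapping.keys m'"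
  have "eval_monom (m + m') x = (\<Prod>v\<in>?A. x v ^ Poly_Mapping.lookup (m + m') v)"
    by (rule eval_monom_superset) (auto simp: in_keys_iff lookup_add)
  also have "\<dots> = (\<Prod>v\<in>?A. x v ^ Poly_Mapping.lookup m v) * (\<Prod>v\<in>?A. x v ^ Poly_Mapping.lookup m' v)"
    by (simp add: lookup_add power_add prod.distrib)
  also have "\<dots> = eval_monom m x * eval_monom m' x"
    by (subst (1 2) eval_monom_superset[of ?A]) auto
  finally show ?thesis .
qed

lemma eval_poly_superset:
  assumes "finite A" "Poly_Mapping.keys P \<subseteq> A"
  shows "eval_poly P x = (\<Sum>m\<in>A. Poly_Mapping.lookup P m * eval_monom m x)"
  unfolding eval_poly_def
  by (rule sum.mono_neutral_left) (use assms in \<open>auto simp: in_keys_iff\<close>)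

lemma eval_poly_zero [simp]: "eval_poly 0 x = 0"
  by (simp add: eval_poly_def)

lemma eval_poly_single [simp]: "eval_poly (Poly_Mapping.single m c) x = c * eval_monom m x"
  by (simp add: eval_poly_def)

lemma eval_poly_one [simp]: "eval_poly 1 x = 1"
  by (simp flip: single_one)

lemma eval_poly_add: "eval_poly (P + Q) x = eval_poly P x + eval_poly Q x"
proof -
  let ?A = "Poly_Mapping.keys P \<union> Poly_Mapping.keys Q"
  have "eval_poly (P + Q) x = (\<Sum>m\<in>?A. Poly_Mapping.lookup (P + Q) m * eval_monom m x)"
    by (rule eval_poly_superset) (use Poly_Mapping.keys_add[of P Q] in auto)
  also have "\<dots> = (\<Sum>m\<in>?A. Poly_Mapping.lookup P m * eval_monom m x) +
                  (\<Sum>m\<in>?A. Poly_Mapping.lookup Q m * eval_monom m x)"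
    by (simp add: lookup_add distrib_right sum.distrib)
  also have "\<dots> = eval_poly P x + eval_poly Q x"
    by (subst (1 2) eval_poly_superset[of ?A]) auto
  finally show ?thesis .
qed

lemma eval_poly_sum: "eval_poly (\<Sum>i\<in>I. P i) x = (\<Sum>i\<in>I. eval_poly (P i) x)"
  by (induction I rule: infinite_finite_induct) (auto simp: eval_poly_add)

lemma cpoly_eq_sum_single:
  "P = (\<Sum>m\<in>Poly_Mapping.keys P. Poly_Mapping.single m (Poly_Mapping.lookup P m))"
  by (rule poly_mapping_eqI) (auto simp: lookup_sum lookup_single sum.delta in_keys_iff when_def)

lemma eval_poly_mult: "eval_poly (P * Q) x = eval_poly P x * eval_poly Q x"
proof -
  have "P * Q = (\<Sum>m\<in>Poly_Mapping.keys P. \<Sum>m'\<in>Poly_Mapping.keys Q.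
          Poly_Mapping.single (m + m') (Poly_Mapping.lookup P m * Poly_Mapping.lookup Q m'))"
    by (subst cpoly_eq_sum_single[of P], subst cpoly_eq_sum_single[of Q])
       (simp add: sum_product mult_single)
  then have "eval_poly (P * Q) x = (\<Sum>m\<in>Poly_Mapping.keys P. \<Sum>m'\<in>Poly_Mapping.keys Q.
          (Poly_Mapping.lookup P m * Poly_Mapping.lookup Q m') * (eval_monom m x * eval_monom m' x))"
    by (simp only: eval_poly_sum eval_monom_add eval_poly_single)
  then show ?thesis
    by (simp add: eval_poly_def sum_product mult_ac)
qed

lemma istopology_zariski:
  "istopology (\<lambda>U. \<exists>S :: nat monom cpoly set.
     U = forms n d - {F \<in> forms n d. \<forall>P\<in>S. eval_poly P (Poly_Mapping.lookup F) = 0})"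
    (is "istopology (\<lambda>U. \<exists>S. U = ?D S)")
proof -
  have "?D S \<inter> ?D T = ?D {P * Q |P Q. P \<in> S \<and> Q \<in> T}" for S T :: "nat monom cpoly set"
  proof (intro set_eqI iffI)
    fix F assume "F \<in> ?D S \<inter> ?D T"
    then obtain P Q where "F \<in> forms n d" and PQ: "P \<in> S" "Q \<in> T"
        and "eval_poly (P * Q) (Poly_Mapping.lookup F) \<noteq> 0"
      by (auto simp: eval_poly_mult)
    then show "F \<in> ?D {P * Q |P Q. P \<in> S \<and> Q \<in> T}" by blast
  next
    fix F assume "F \<in> ?D {P * Q |P Q. P \<in> S \<and> Q \<in> T}"
    then show "F \<in> ?D S \<inter> ?D T" by (auto simp: eval_poly_mult)
  qed
  then have "\<exists>R. U \<inter> V = ?D R" if "\<exists>S. U = ?D S" "\<exists>T. V = ?D T" for U V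
    using that by (elim exE) (simp only:, blast)
  moreover have "\<exists>R. \<Union>\<K> = ?D R" if "\<forall>K\<in>\<K>. \<exists>S. K = ?D S" for \<K>
  proof -
    from bchoice[OF that] obtain S where S: "\<forall>K\<in>\<K>. K = ?D (S K)" ..
    have "\<Union>\<K> = (\<Union>K\<in>\<K>. K)" by simp
    also have "\<dots> = (\<Union>K\<in>\<K>. ?D (S K))"
      by (rule SUP_cong[OF refl]) (rule S[rule_format])
    also have "\<dots> = ?D (\<Union>K\<in>\<K>. S K)" by blast
    finally show ?thesis by (rule exI)
  qed
  ultimately show ?thesis unfolding istopology_def by (intro conjI allI impI)
qed

lemma openin_zariski:
  "openin (zariski n d) U \<longleftrightarrow> (\<exists>S :: nat monom cpoly set.
     U = forms n d - {F \<in> forms n d. \<forall>P\<in>S. eval_poly P (Poly_Mapping.lookup F) = 0})"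
  unfolding zariski_def topology_inverse'[OF istopology_zariski] ..

lemma topspace_zariski [simp]: "topspace (zariski n d) = forms n d"
proof
  show "topspace (zariski n d) \<subseteq> forms n d"
    by (auto simp: topspace_def openin_zariski)
  have "openin (zariski n d) (forms n d)"
    unfolding openin_zariski by (rule exI[of _ "{1}"]) simp
  then show "forms n d \<subseteq> topspace (zariski n d)" by (rule openin_subset)
qed

end

theory Submission
  imports Defs "HOL-Computational_Algebra.Fundamental_Theorem_Algebra"
begin

text \<open>The rank of a monomial is bounded from above by an explicit decomposition, and the
generic rank is bounded from below by counting parameters. For \<open>n \<ge> 4\<close> an
elementary inequality separates the two bounds.

\<^bold>\<open>Upper bound.\<close> If \<open>a\<^sub>u\<close> is the least positive exponent of
the monomial, averaging \<open>d\<close>-th powers of linear forms over roots of unity writes it as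
a sum of \<open>\<Prod>\<^sub>v (a\<^sub>v + 1)\<close> powers, where \<open>v\<close> runs over the
other variables (\<open>power_sum_monomial\<close>). As the exponents add up to \<open>d\<close> and
\<open>a\<^sub>u \<ge> 1\<close>, the inequality of arithmetic and geometric means bounds this by
the power \<open>n - 1\<close> of \<open>(d + n - 2) / (n - 1)\<close>. This is less than \<open>N /
n\<close>, where \<open>N\<close> is the number of monomials of degree \<open>d\<close> in
\<open>n\<close> variables, by induction on \<open>n\<close> starting from \<open>n = 4\<close>
(\<open>mean_power_less_card_monoms\<close>).

\<^bold>\<open>Lower bound.\<close> A sum of \<open>r\<close> powers of linear forms depends on
\<open>n r\<close> parameters. If \<open>n r < N\<close>, the \<open>N\<close> coefficients of such
a sum are algebraically dependent (\<open>algebraic_relation\<close>), so most forms are not of this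
kind.

\<^bold>\<open>Existence of the generic rank.\<close> The generic rank is defined as the unique
value of the rank on a dense open set, and the lower bound says something about it only once such a
value is known to exist. The sums of \<open>r\<close> powers form the projection of a Zariski-closed
set, hence a constructible set (\<open>constructible_project\<close>, proved by eliminating one
variable at a time). A constructible set or its complement contains a nonempty open set
(\<open>constructible_generic_or_cogeneric\<close>). So for the least \<open>r\<close> such that
sums of \<open>r\<close> powers contain a nonempty open set, there is also a nonempty open set of
forms that are not sums of \<open>r - 1\<close> powers. On the intersection, which is nonempty and
dense since affine space is irreducible, the rank is \<open>r\<close>
(\<open>card_monoms_le_generic_waring_rank\<close>).\<close>

section \<open>Polynomial functions and generic sets\<close>

inductive polyfun :: "(('v \<Rightarrow> complex) \<Rightarrow> complex) \<Rightarrow> bool" where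
  const: "polyfun (\<lambda>x. c)"
| var: "polyfun (\<lambda>x. x v)"
| add: "polyfun p \<Longrightarrow> polyfun q \<Longrightarrow> polyfun (\<lambda>x. p x + q x)"
| mult: "polyfun p \<Longrightarrow> polyfun q \<Longrightarrow> polyfun (\<lambda>x. p x * q x)"

lemma polyfun_diff: "polyfun p \<Longrightarrow> polyfun q \<Longrightarrow> polyfun (\<lambda>x. p x - q x)"
  using polyfun.add[of p "\<lambda>x. (-1) * q x"] polyfun.mult[OF polyfun.const[of "-1"], of q] by simp

lemma polyfun_sum: "(\<And>i. i \<in> I \<Longrightarrow> polyfun (p i)) \<Longrightarrow> polyfun (\<lambda>x. \<Sum>i\<in>I. p i x)"
  by (induction I rule: infinite_finite_induct) (auto intro: polyfun.intros)

lemma polyfun_prod: "(\<And>i. i \<in> I \<Longrightarrow> polyfun (p i)) \<Longrightarrow> polyfun (\<lambda>x. \<Prod>i\<in>I. p i x)"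
  by (induction I rule: infinite_finite_induct) (auto intro: polyfun.intros)

lemma polyfun_power: "polyfun p \<Longrightarrow> polyfun (\<lambda>x. p x ^ k)"
  by (induction k) (auto intro: polyfun.intros)

lemma polyfun_comp:
  assumes "polyfun p" "\<And>v. polyfun (\<lambda>x. s x v)"
  shows "polyfun (\<lambda>x. p (s x))"
  using assms(1) by induction (auto intro: polyfun.intros assms(2))

lemma polyfun_eval_poly: "polyfun (eval_poly P)"
  unfolding eval_poly_def[abs_def] eval_monom_def
  by (intro polyfun_sum polyfun.mult polyfun.const polyfun_prod polyfun_power polyfun.var)

lemma polyfun_imp_eval_poly:
  assumes "polyfun p"
  shows "\<exists>P. \<forall>x. p x = eval_poly P x"
  using assms
proof induction
  case (const c)
  show ?case by (rule exI[of _ "Poly_Mapping.single 0 c"]) simp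
next
  case (var v)
  show ?case
    by (rule exI[of _ "Poly_Mapping.single (Poly_Mapping.single v 1) 1"]) (simp add: eval_monom_def)
next
  case (add p q)
  then show ?case by (metis eval_poly_add)
next
  case (mult p q)
  then show ?case by (metis eval_poly_mult)
qed

text \<open>Lines reduce the irreducibility of affine space to the fact that a product of nonzero
polynomials in one variable is nonzero.\<close>

lemma polyfun_on_line:
  assumes "polyfun p"
  shows "\<exists>q. \<forall>t. p (\<lambda>v. x v + t * (y v - x v)) = poly q t"
  using assms
proof induction
  case (const c)
  show ?case by (rule exI[of _ "[:c:]"]) simp
next
  case (var v)
  show ?case by (rule exI[of _ "[:x v, y v - x v:]"]) simp
next
  case (add p q)
  then show ?case by (metis poly_add)
next
  case (mult p q)
  then show ?case by (metis poly_mult)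
qed

text \<open>Affine space is irreducible: on the line through a point where \<open>p\<close> does not
vanish and a point where \<open>q\<close> does not vanish, both restrict to nonzero polynomials in
one variable, and so does their product.\<close>

lemma polyfun_common_nonzero:
  assumes "polyfun p" "polyfun q" "p x \<noteq> 0" "q y \<noteq> 0"
  shows "\<exists>z. p z * q z \<noteq> 0"
proof -
  obtain f where f: "\<And>t. p (\<lambda>v. x v + t * (y v - x v)) = poly f t"
    using polyfun_on_line[OF assms(1), of x y] by blast
  obtain g where g: "\<And>t. q (\<lambda>v. x v + t * (y v - x v)) = poly g t"
    using polyfun_on_line[OF assms(2), of x y] by blast
  have "poly f 0 \<noteq> 0" "poly g 1 \<noteq> 0"
    using assms(3,4) by (simp_all flip: f g)
  then have "f * g \<noteq> 0" by auto
  then obtain t where t: "poly (f * g) t \<noteq> 0"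
    using poly_all_0_iff_0 by blast
  show ?thesis
    by (rule exI[of _ "\<lambda>v. x v + t * (y v - x v)"]) (use t in \<open>simp add: f g\<close>)
qed

text \<open>By irreducibility, the sets that contain a nonempty principal Zariski-open set form a
proper filter, so ``generic'' behaves like ``almost everywhere''.\<close>

definition generic :: "('v \<Rightarrow> complex) set \<Rightarrow> bool" where
  "generic S \<longleftrightarrow> (\<exists>p. polyfun p \<and> (\<exists>x. p x \<noteq> 0) \<and> {x. p x \<noteq> 0} \<subseteq> S)"

lemma genericI: "polyfun p \<Longrightarrow> p x \<noteq> 0 \<Longrightarrow> {x. p x \<noteq> 0} \<subseteq> S \<Longrightarrow> generic S"
  unfolding generic_def by (rule exI[of _ p]) auto

lemma genericE:
  assumes "generic S"
  obtains p x where "polyfun p" "p x \<noteq> 0" "{x. p x \<noteq> 0} \<subseteq> S"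
proof -
  from assms obtain p where p: "polyfun p \<and> (\<exists>x. p x \<noteq> 0) \<and> {x. p x \<noteq> 0} \<subseteq> S"
    unfolding generic_def ..
  then have "\<exists>x. p x \<noteq> 0" by (rule conjunct2[THEN conjunct1])
  then obtain x where "p x \<noteq> 0" ..
  with p show thesis using that[of p x] by simp
qed

lemma generic_mono: "generic A \<Longrightarrow> A \<subseteq> B \<Longrightarrow> generic B"
  unfolding generic_def by (meson subset_trans)

lemma generic_nonempty: "generic S \<Longrightarrow> S \<noteq> {}"
  by (elim genericE) auto

lemma generic_UNIV: "generic UNIV"
  by (rule genericI[OF polyfun.const[of 1]]) auto

lemma generic_Int:
  assumes "generic A" "generic B"
  shows "generic (A \<inter> B)"
proof -
  have 1: "\<exists>p. polyfun p \<and> (\<exists>x. p x \<noteq> 0) \<and> {x. p x \<noteq> 0} \<subseteq> A"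
    using assms(1) unfolding generic_def .
  have 2: "\<exists>p. polyfun p \<and> (\<exists>x. p x \<noteq> 0) \<and> {x. p x \<noteq> 0} \<subseteq> B"
    using assms(2) unfolding generic_def .
  have 3: "generic (A \<inter> B)"
    if p: "polyfun p" "\<exists>x. p x \<noteq> 0" "{x. p x \<noteq> 0} \<subseteq> A"
    and q: "polyfun q" "\<exists>x. q x \<noteq> 0" "{x. q x \<noteq> 0} \<subseteq> B" for p q
  proof -
    have "\<exists>x. p x * q x \<noteq> 0" using p(2) q(2) polyfun_common_nonzero[OF p(1) q(1)] by (elim exE)
    moreover have "{x. p x * q x \<noteq> 0} \<subseteq> A \<inter> B" using p(3) q(3) by auto
    ultimately show ?thesis
      unfolding generic_def using polyfun.mult[OF p(1) q(1)] by (intro exI[of _ "\<lambda>x. p x * q x"] conjI)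
  qed
  show ?thesis
    by (rule exE[OF 1], rule exE[OF 2], elim conjE, rule 3)
qed
section \<open>Constructible sets\<close>

text \<open>Locally closed sets that are given by finitely many equations and one inequation; finite
unions of them are the constructible sets. In this normal form a projection can be computed on one
basic set at a time, because existential quantification distributes over unions.\<close>

definition basic_set :: "(('v \<Rightarrow> complex) \<Rightarrow> complex) set \<Rightarrow> (('v \<Rightarrow> complex) \<Rightarrow> complex) \<Rightarrow> ('v \<Rightarrow> complex) set"
  where "basic_set P q = {x. (\<forall>p\<in>P. p x = 0) \<and> q x \<noteq> 0}"

inductive constructible :: "('v \<Rightarrow> complex) set \<Rightarrow> bool" where
  basic: "finite P \<Longrightarrow> \<forall>p\<in>P. polyfun p \<Longrightarrow> polyfun q \<Longrightarrow> constructible (basic_set P q)"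
| union: "constructible A \<Longrightarrow> constructible B \<Longrightarrow> constructible (A \<union> B)"

lemma constructible_zero: "polyfun p \<Longrightarrow> constructible {x. p x = 0}"
  using constructible.basic[of "{p}" "\<lambda>x. 1"] by (auto simp: basic_set_def intro: polyfun.intros)

lemma constructible_nonzero: "polyfun q \<Longrightarrow> constructible {x. q x \<noteq> 0}"
  using constructible.basic[of "{}" q] by (auto simp: basic_set_def)

lemma constructible_empty: "constructible {}"
  using constructible_nonzero[OF polyfun.const[of 0]] by simp

lemma constructible_Int:
  assumes "constructible A" "constructible B"
  shows "constructible (A \<inter> B)"
  using assms(1)
proof induction
  case AB: (basic P q)
  show ?case using assms(2)
  proof induction
    case (basic P' q')
    have "basic_set P q \<inter> basic_set P' q' = basic_set (P \<union> P') (\<lambda>x. q x * q' x)"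
      by (auto simp: basic_set_def)
    also have "constructible \<dots>"
      using AB basic by (intro constructible.basic polyfun.mult) auto
    finally show ?case .
  next
    case (union A B)
    then show ?case by (auto simp: Int_Un_distrib intro: constructible.union)
  qed
next
  case (union A B)
  then show ?case by (auto simp: Int_Un_distrib2 intro: constructible.union)
qed

lemma constructible_UN:
  "finite I \<Longrightarrow> (\<And>i. i \<in> I \<Longrightarrow> constructible (A i)) \<Longrightarrow> constructible (\<Union>i\<in>I. A i)"
  by (induction I rule: finite_induct) (auto intro: constructible_empty constructible.union)

text \<open>A basic set with a nontrivial equation misses the open set where that equation fails;
one whose equations are all trivial is itself open. So a basic set decides genericity, and unions
inherit the dichotomy because generic sets are closed under intersection. This is what makes generic
values of the rank exist.\<close>

lemma constructible_generic_or_cogeneric: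
  assumes "constructible S"
  shows "generic S \<or> generic (- S)"
  using assms
proof induction
  case (basic P q)
  consider p x where "p \<in> P" "p x \<noteq> 0" | y where "\<forall>p\<in>P. \<forall>x. p x = 0" "q y \<noteq> 0"
    | "\<forall>x. q x = 0" by blast
  then show ?case
  proof cases
    case 1
    with basic have "generic (- basic_set P q)"
      by (intro genericI[of p x]) (auto simp: basic_set_def)
    then show ?thesis ..
  next
    case 2
    with basic have "generic (basic_set P q)"
      by (intro genericI[of q y]) (auto simp: basic_set_def)
    then show ?thesis ..
  next
    case 3
    then have "- basic_set P q = UNIV" by (auto simp: basic_set_def)
    then have "generic (- basic_set P q)" by (simp only: generic_UNIV)
    then show ?thesis ..
  qed
next
  case (union A B)
  show ?case
  proof (cases "generic A \<or> generic B")
    case True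
    then show ?thesis using generic_mono[of A "A \<union> B"] generic_mono[of B "A \<union> B"] by auto
  next
    case False
    with union.IH have "generic (- A \<inter> - B)" by (intro generic_Int) auto
    then show ?thesis by simp
  qed
qed

section \<open>Elimination of a variable\<close>

text \<open>A polynomial in one distinguished variable whose coefficients are polynomial functions
of \<open>x\<close>. The bound is strict (\<open>degree < D\<close> or zero polynomial), so that
\<open>D = 0\<close> means the zero family and each reduction step lowers \<open>D\<close> by one
without a special case for constants.\<close>

definition polyfam :: "nat \<Rightarrow> (('v \<Rightarrow> complex) \<Rightarrow> complex poly) \<Rightarrow> bool" where
  "polyfam D f \<longleftrightarrow> (\<forall>i. polyfun (\<lambda>x. coeff (f x) i)) \<and> (\<forall>x. \<forall>i\<ge>D. coeff (f x) i = 0)"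

lemma polyfam_coeff: "polyfam D f \<Longrightarrow> polyfun (\<lambda>x. coeff (f x) i)"
  by (simp add: polyfam_def)

lemma polyfam_mult:
  assumes "polyfam D f" "polyfam E g"
  shows "polyfam (D + E) (\<lambda>x. f x * g x)"
  unfolding polyfam_def
proof (intro conjI allI impI)
  show "polyfun (\<lambda>x. coeff (f x * g x) i)" for i
    unfolding coeff_mult
    by (intro polyfun_sum polyfun.mult polyfam_coeff[OF assms(1)] polyfam_coeff[OF assms(2)])
  show "coeff (f x * g x) i = 0" if "D + E \<le> i" for x i
    unfolding coeff_mult
  proof (intro sum.neutral ballI)
    fix j assume "j \<in> {..i}"
    then have "j \<ge> D \<or> i - j \<ge> E" using that by auto
    then show "coeff (f x) j * coeff (g x) (i - j) = 0"
      using assms by (auto simp: polyfam_def)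
  qed
qed

lemma polyfam_add:
  assumes "polyfam D f" "polyfam D g"
  shows "polyfam D (\<lambda>x. f x + g x)"
  using assms by (auto simp: polyfam_def intro: polyfun.add)

lemma polyfam_diff:
  assumes "polyfam D f" "polyfam D g"
  shows "polyfam D (\<lambda>x. f x - g x)"
  using assms by (auto simp: polyfam_def intro: polyfun_diff)

lemma polyfam_mono: "polyfam D f \<Longrightarrow> D \<le> E \<Longrightarrow> polyfam E f"
  by (auto simp: polyfam_def)

lemma polyfam_monom:
  assumes "polyfun p" "k < D"
  shows "polyfam D (\<lambda>x. monom (p x) k)"
  unfolding polyfam_def coeff_monom
proof (intro conjI allI impI)
  show "polyfun (\<lambda>x. if k = i then p x else 0)" for i
    by (cases "k = i") (simp_all add: assms(1) polyfun.const)
  show "(if k = i then p x else 0) = 0" if "D \<le> i" for x i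
    using that assms(2) by simp
qed

lemma polyfam_one: "polyfam 1 (\<lambda>x. 1)"
  by (auto simp: polyfam_def intro: polyfun.const)

lemma polyfam_power: "polyfam D f \<Longrightarrow> \<exists>E. polyfam E (\<lambda>x. f x ^ k)"
proof (induction k)
  case 0
  show ?case using polyfam_one by auto
next
  case (Suc k)
  then obtain E where "polyfam E (\<lambda>x. f x ^ k)" by blast
  from polyfam_mult[OF Suc.prems this] show ?case by auto
qed

lemma polyfam_Suc_reduce:
  assumes "polyfam (Suc D) f" "\<And>x. coeff (f x) D = 0"
  shows "polyfam D f"
  unfolding polyfam_def
proof (intro conjI allI impI)
  show "polyfun (\<lambda>x. coeff (f x) i)" for i by (rule polyfam_coeff[OF assms(1)])
  show "coeff (f x) i = 0" if "D \<le> i" for x i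
    using assms that by (cases "i = D") (simp_all add: polyfam_def)
qed

lemma polyfun_in_variable:
  assumes "polyfun p"
  shows "\<exists>D f. polyfam D f \<and> (\<forall>x t. p (x(k := t)) = poly (f x) t)"
  using assms
proof induction
  case (const c)
  show ?case
    by (rule exI[of _ 1], rule exI[of _ "\<lambda>x. monom c 0"])
       (auto intro: polyfam_monom polyfun.const simp: poly_monom)
next
  case (var v)
  show ?case
  proof (cases "v = k")
    case True
    then show ?thesis
      by (intro exI[of _ 2] exI[of _ "\<lambda>x. monom 1 1"])
         (auto intro: polyfam_monom polyfun.const simp: poly_monom)
  next
    case False
    then show ?thesis
      by (intro exI[of _ 1] exI[of _ "\<lambda>x. monom (x v) 0"])
         (auto intro: polyfam_monom polyfun.var simp: poly_monom)
  qed
next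
  case (add p q)
  then obtain D f E g where f: "polyfam D f" "\<forall>x t. p (x(k := t)) = poly (f x) t"
      and g: "polyfam E g" "\<forall>x t. q (x(k := t)) = poly (g x) t" by blast
  have "polyfam (max D E) (\<lambda>x. f x + g x)"
    by (intro polyfam_add polyfam_mono[OF f(1)] polyfam_mono[OF g(1)]) auto
  with f(2) g(2) show ?case
    by (intro exI[of _ "max D E"] exI[of _ "\<lambda>x. f x + g x"]) (simp del: fun_upd_apply)
next
  case (mult p q)
  then obtain D f E g where f: "polyfam D f" "\<forall>x t. p (x(k := t)) = poly (f x) t"
      and g: "polyfam E g" "\<forall>x t. q (x(k := t)) = poly (g x) t" by blast
  with polyfam_mult[OF f(1) g(1)] show ?case
    by (intro exI[of _ "D + E"] exI[of _ "\<lambda>x. f x * g x"]) (simp del: fun_upd_apply)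
qed

text \<open>One step of pseudo-division: a cross-multiple of \<open>f\<close> is subtracted so that
the leading terms cancel, without division by the leading coefficient of \<open>f\<close>, which may
vanish for some \<open>x\<close>.\<close>

lemma polyfam_cancel:
  assumes f: "polyfam (Suc D) f" and h: "polyfam (Suc E) h" and "D \<le> E"
  shows "polyfam E (\<lambda>x. monom (coeff (f x) D) 0 * h x - monom (coeff (h x) E) (E - D) * f x)"
proof (rule polyfam_Suc_reduce)
  have c: "polyfam 1 (\<lambda>x. monom (coeff (f x) D) 0)"
    by (rule polyfam_monom[OF polyfam_coeff[OF f]]) simp
  have c': "polyfam (E - D + 1) (\<lambda>x. monom (coeff (h x) E) (E - D))"
    by (rule polyfam_monom[OF polyfam_coeff[OF h]]) simp
  have m: "coeff (monom a k * r) i = (if k \<le> i then a * coeff r (i - k) else 0)" for a k i and r :: "complex poly"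
    by (simp add: coeff_monom_mult)
  have fz: "coeff (f x) i = 0" if "i > D" for x i using f that by (auto simp: polyfam_def)
  have hz: "coeff (h x) i = 0" if "i > E" for x i using h that by (auto simp: polyfam_def)
  show "polyfam (Suc E) (\<lambda>x. monom (coeff (f x) D) 0 * h x - monom (coeff (h x) E) (E - D) * f x)"
    unfolding polyfam_def
  proof (intro conjI allI impI)
    show "polyfun (\<lambda>x. coeff (monom (coeff (f x) D) 0 * h x - monom (coeff (h x) E) (E - D) * f x) i)" for i
      unfolding coeff_diff
      by (intro polyfun_diff polyfam_coeff[OF polyfam_mult[OF c h]] polyfam_coeff[OF polyfam_mult[OF c' f]])
    show "coeff (monom (coeff (f x) D) 0 * h x - monom (coeff (h x) E) (E - D) * f x) i = 0"
      if "Suc E \<le> i" for x i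
      using that \<open>D \<le> E\<close> by (simp add: m fz hz)
  qed
  show "coeff (monom (coeff (f x) D) 0 * h x - monom (coeff (h x) E) (E - D) * f x) E = 0" for x
    using \<open>D \<le> E\<close> by (simp add: m)
qed

lemma polyfam_drop_lead:
  assumes f: "polyfam (Suc D) f"
  shows "polyfam D (\<lambda>x. f x - monom (coeff (f x) D) D)"
  by (rule polyfam_Suc_reduce, rule polyfam_diff[OF f], rule polyfam_monom[OF polyfam_coeff[OF f]]) auto

text \<open>Where the leading coefficient of \<open>f\<close> does not vanish, a pseudo-division
step does not affect divisibility by \<open>f\<close>. After finitely many steps \<open>h\<close>
has smaller degree than \<open>f\<close>, and then divisibility just says that all coefficients of
\<open>h\<close> are zero.\<close>

lemma constructible_not_dvd:
  assumes f: "polyfam (Suc D) f" and h: "polyfam E h"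
  shows "constructible {x. coeff (f x) D \<noteq> 0 \<and> \<not> f x dvd h x}"
  using h
proof (induction E arbitrary: h)
  case 0
  then have "h x = 0" for x
    by (intro poly_eqI) (auto simp: polyfam_def)
  then show ?case using constructible_empty by simp
next
  case (Suc E)
  show ?case
  proof (cases "D \<le> E")
    case True
    define h' where "h' = (\<lambda>x. monom (coeff (f x) D) 0 * h x - monom (coeff (h x) E) (E - D) * f x)"
    have "polyfam E h'"
      unfolding h'_def by (rule polyfam_cancel[OF f Suc.prems True])
    have "f x dvd h x \<longleftrightarrow> f x dvd h' x" if "coeff (f x) D \<noteq> 0" for x
    proof -
      have "f x dvd h' x \<longleftrightarrow> f x dvd monom (coeff (f x) D) 0 * h x"
        unfolding h'_def by (rule dvd_diff_left_iff) simp
      also have "\<dots> \<longleftrightarrow> f x dvd h x"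
        using that by (simp add: monom_0 dvd_smult_iff)
      finally show ?thesis ..
    qed
    then have "{x. coeff (f x) D \<noteq> 0 \<and> \<not> f x dvd h x} = {x. coeff (f x) D \<noteq> 0 \<and> \<not> f x dvd h' x}"
      by blast
    then show ?thesis using Suc.IH[OF \<open>polyfam E h'\<close>] by simp
  next
    case False
    have "f x dvd h x \<longleftrightarrow> (\<forall>i<Suc E. coeff (h x) i = 0)" if "coeff (f x) D \<noteq> 0" for x
    proof
      assume "f x dvd h x"
      have "h x = 0"
      proof (rule ccontr)
        assume "h x \<noteq> 0"
        then have "coeff (h x) (degree (h x)) \<noteq> 0" by simp
        then have "degree (h x) < Suc E"
          using Suc.prems by (metis polyfam_def not_le)
        moreover have "degree (f x) \<le> degree (h x)"
          using dvd_imp_degree_le[OF \<open>f x dvd h x\<close> \<open>h x \<noteq> 0\<close>] .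
        moreover have "D \<le> degree (f x)" using that by (rule le_degree)
        ultimately show False using False by simp
      qed
      then show "\<forall>i<Suc E. coeff (h x) i = 0" by simp
    next
      assume "\<forall>i<Suc E. coeff (h x) i = 0"
      then have "h x = 0"
        using Suc.prems by (intro poly_eqI) (metis coeff_0 not_le polyfam_def)
      then show "f x dvd h x" by simp
    qed
    then have "{x. coeff (f x) D \<noteq> 0 \<and> \<not> f x dvd h x} =
        {x. coeff (f x) D \<noteq> 0} \<inter> (\<Union>i\<in>{..<Suc E}. {x. coeff (h x) i \<noteq> 0})"
      by auto
    also have "constructible \<dots>"
      by (intro constructible_Int constructible_UN constructible_nonzero polyfam_coeff[OF f]
            polyfam_coeff[OF Suc.prems]) auto
    finally show ?thesis .
  qed
qed

text \<open>Quantifier elimination over the complex numbers for one variable. If two equations are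
left, pseudo-division of the one of larger degree by the other is used where the leading coefficient
of the latter is nonzero; where it is zero, the leading term is dropped. In both cases the total
degree goes down. A single equation \<open>f = 0\<close> with nonzero leading coefficient has a root
outside the zeros of \<open>g\<close> iff \<open>f\<close> does not divide \<open>g\<close> to the
power \<open>degree f\<close>, by the Nullstellensatz in one variable.\<close>

lemma constructible_exists_root:
  assumes g: "polyfam E g"
  shows "\<forall>(D,f)\<in>set fs. polyfam D f \<Longrightarrow> constructible {x. \<exists>t. (\<forall>(D,f)\<in>set fs. poly (f x) t = 0) \<and> poly (g x) t \<noteq> 0}"
proof (induction "\<Sum>(D,f)\<leftarrow>fs. Suc D" arbitrary: fs rule: less_induct)
  case less
  \<comment> \<open>The facts \<open>low\<close> and \<open>two\<close> allow the list to be permuted relative to \<open>fs\<close>: only its set and its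
      total bound matter.\<close>
  let ?S = "\<lambda>fs. {x. \<exists>t. (\<forall>(D,f)\<in>set fs. poly (f x) t = 0) \<and> poly (g x) t \<noteq> 0}"
  have low: "constructible ({x. coeff (f x) D = 0} \<inter> ?S ((Suc D, f) # vs))"
    if fs: "set fs = set ((Suc D, f) # vs)"
      and s: "(\<Sum>(D,f)\<leftarrow>fs. Suc D) = (\<Sum>(D,f)\<leftarrow>(Suc D, f) # vs. Suc D)" for D f vs
  proof -
    define f' where "f' = (\<lambda>x. f x - monom (coeff (f x) D) D)"
    have f: "polyfam (Suc D) f" using less.prems fs by auto
    have f': "polyfam D f'" unfolding f'_def by (rule polyfam_drop_lead[OF f])
    have "{x. coeff (f x) D = 0} \<inter> ?S ((Suc D, f) # vs) =
          {x. coeff (f x) D = 0} \<inter> ?S ((D, f') # vs)"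
      by (auto simp: f'_def)
    also have "constructible \<dots>"
      using less.prems fs f' s
      by (intro constructible_Int constructible_zero polyfam_coeff[OF f] less.hyps) auto
    finally show ?thesis .
  qed
  have split: "constructible (?S gs)"
    if "polyfun c" "constructible ({x. c x = 0} \<inter> ?S gs)" "constructible ({x. c x \<noteq> 0} \<inter> ?S gs)" for c gs
  proof -
    have "?S gs = ({x. c x = 0} \<inter> ?S gs) \<union> ({x. c x \<noteq> 0} \<inter> ?S gs)" by blast
    then show ?thesis using constructible.union[OF that(2,3)] by simp
  qed
  have two: "constructible (?S ((Suc D, f) # (Suc E, h) # gs))"
    if fs: "set fs = set ((Suc D, f) # (Suc E, h) # gs)"
      and s: "(\<Sum>(D,f)\<leftarrow>fs. Suc D) = (\<Sum>(D,f)\<leftarrow>(Suc D, f) # (Suc E, h) # gs. Suc D)"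
      and DE: "D \<le> E" for D f E h gs
  proof (rule split[of "\<lambda>x. coeff (f x) D"])
    have f: "polyfam (Suc D) f" and h: "polyfam (Suc E) h" using less.prems fs by auto
    show "polyfun (\<lambda>x. coeff (f x) D)" by (rule polyfam_coeff[OF f])
    show "constructible ({x. coeff (f x) D = 0} \<inter> ?S ((Suc D, f) # (Suc E, h) # gs))"
      using low[of D f "(Suc E, h) # gs"] fs s by simp
    define h' where "h' = (\<lambda>x. monom (coeff (f x) D) 0 * h x - monom (coeff (h x) E) (E - D) * f x)"
    have h': "polyfam E h'" unfolding h'_def by (rule polyfam_cancel[OF f h DE])
    have "{x. coeff (f x) D \<noteq> 0} \<inter> ?S ((Suc D, f) # (Suc E, h) # gs) =
          {x. coeff (f x) D \<noteq> 0} \<inter> ?S ((Suc D, f) # (E, h') # gs)"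
      by (auto simp: h'_def poly_monom)
    also have "constructible \<dots>"
      using less.prems fs h' s
      by (intro constructible_Int constructible_nonzero polyfam_coeff[OF f] less.hyps) auto
    finally show "constructible ({x. coeff (f x) D \<noteq> 0} \<inter> ?S ((Suc D, f) # (Suc E, h) # gs))" .
  qed
  show ?case
  proof (cases "\<exists>f. (0, f) \<in> set fs")
    case True
    then obtain f us vs where fs: "fs = us @ (0, f) # vs" by (meson split_list)
    then have "polyfam 0 f" using less.prems by auto
    then have "f x = 0" for x by (intro poly_eqI) (auto simp: polyfam_def)
    then have "?S fs = ?S (us @ vs)" by (auto simp: fs)
    moreover have "constructible (?S (us @ vs))"
      using less.prems by (intro less.hyps) (auto simp: fs)
    ultimately show ?thesis by simp
  next
    case False
    consider "fs = []" | D f where "fs = [(Suc D, f)]"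
      | D f E h gs where "fs = (Suc D, f) # (Suc E, h) # gs"
    proof (cases fs)
      case (Cons a list)
      then obtain D f where a: "a = (Suc D, f)" using False
        by (metis list.set_intros(1) not0_implies_Suc surj_pair)
      show thesis
      proof (cases list)
        case Nil
        then show ?thesis using that Cons a by auto
      next
        case (Cons b gs)
        then obtain E h where b: "b = (Suc E, h)" using False \<open>fs = a # list\<close>
          by (metis list.set_intros(1,2) not0_implies_Suc surj_pair)
        then show ?thesis using that Cons a \<open>fs = a # list\<close> by auto
      qed
    qed
    then show ?thesis
    proof cases
      case 1
      have "?S fs = (\<Union>i\<in>{..<E}. {x. coeff (g x) i \<noteq> 0})"
      proof (intro set_eqI)
        fix x
        have "x \<in> ?S fs \<longleftrightarrow> g x \<noteq> 0" using poly_all_0_iff_0[of "g x"] 1 by auto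
        also have "\<dots> \<longleftrightarrow> (\<exists>i<E. coeff (g x) i \<noteq> 0)"
          using g by (metis coeff_0 leading_coeff_0_iff not_le polyfam_def)
        finally show "x \<in> ?S fs \<longleftrightarrow> x \<in> (\<Union>i\<in>{..<E}. {x. coeff (g x) i \<noteq> 0})" by blast
      qed
      then show ?thesis
        by (simp add: constructible_UN constructible_nonzero polyfam_coeff[OF g])
    next
      case 2
      then have f: "polyfam (Suc D) f" using less.prems by auto
      obtain E' where gD: "polyfam E' (\<lambda>x. g x ^ D)" using polyfam_power[OF g] by blast
      show ?thesis
      proof (rule split[of "\<lambda>x. coeff (f x) D"])
        show "polyfun (\<lambda>x. coeff (f x) D)" by (rule polyfam_coeff[OF f])
        show "constructible ({x. coeff (f x) D = 0} \<inter> ?S fs)"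
          using low[of D f "[]"] 2 by simp
        have "(\<exists>t. poly (f x) t = 0 \<and> poly (g x) t \<noteq> 0) \<longleftrightarrow> \<not> f x dvd g x ^ D"
          if "coeff (f x) D \<noteq> 0" for x
        proof -
          have "degree (f x) = D"
            using f that by (intro antisym le_degree degree_le) (auto simp: polyfam_def)
          moreover have "f x \<noteq> 0" using that by auto
          ultimately show ?thesis using nullstellensatz_univariate[of "f x" "g x"] by auto
        qed
        then have "{x. coeff (f x) D \<noteq> 0} \<inter> ?S fs = {x. coeff (f x) D \<noteq> 0 \<and> \<not> f x dvd g x ^ D}"
          by (auto simp: 2)
        then show "constructible ({x. coeff (f x) D \<noteq> 0} \<inter> ?S fs)"
          using constructible_not_dvd[OF f gD] by simp
      qed
    next
      case 3
      show ?thesis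
      proof (cases "D \<le> E")
        case True
        then show ?thesis using two[of D f E h gs] 3 by simp
      next
        case False
        have "?S fs = ?S ((Suc E, h) # (Suc D, f) # gs)" by (auto simp: 3)
        then show ?thesis using two[of E h D f gs] 3 False by (simp add: insert_commute)
      qed
    qed
  qed
qed

lemma constructible_project_one:
  assumes "constructible S"
  shows "constructible {x. \<exists>t. x(k := t) \<in> S}"
  using assms
proof induction
  case (basic P q)
  obtain E g where g: "polyfam E g" "\<And>x t. q (x(k := t)) = poly (g x) t"
    using polyfun_in_variable[OF basic(3), of k] by blast
  have "\<forall>p\<in>P. \<exists>Df. polyfam (fst Df) (snd Df) \<and> (\<forall>x t. p (x(k := t)) = poly (snd Df x) t)"
  proof
    fix p assume "p \<in> P"
    then have "polyfun p" using basic(2) by blast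
    from polyfun_in_variable[OF this, of k]
    obtain D f where "polyfam D f \<and> (\<forall>x t. p (x(k := t)) = poly (f x) t)" by blast
    then show "\<exists>Df. polyfam (fst Df) (snd Df) \<and> (\<forall>x t. p (x(k := t)) = poly (snd Df x) t)"
      by (intro exI[of _ "(D, f)"]) simp
  qed
  from bchoice[OF this] obtain F where F: "\<And>p. p \<in> P \<Longrightarrow> polyfam (fst (F p)) (snd (F p))"
      "\<And>p x t. p \<in> P \<Longrightarrow> p (x(k := t)) = poly (snd (F p) x) t" by blast
  obtain ps where ps: "set ps = P" using finite_list[OF basic(1)] ..
  have "{x. \<exists>t. x(k := t) \<in> basic_set P q} =
        {x. \<exists>t. (\<forall>(D,f)\<in>set (map F ps). poly (f x) t = 0) \<and> poly (g x) t \<noteq> 0}"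
    by (auto simp: basic_set_def g(2) F(2) ps split_beta)
  also have "constructible \<dots>"
    by (rule constructible_exists_root[OF g(1)]) (auto simp: ps split_beta F(1))
  finally show ?case .
next
  case (union A B)
  have "{x. \<exists>t. x(k := t) \<in> A \<union> B} = {x. \<exists>t. x(k := t) \<in> A} \<union> {x. \<exists>t. x(k := t) \<in> B}"
    by auto
  then show ?case using constructible.union[OF union.IH] by (simp only:)
qed

text \<open>Chevalley's theorem for coordinate projections, by eliminating one variable at a time.
The result stays in the same space as a cylinder along \<open>K\<close>, so that the steps can be
iterated.\<close>

lemma constructible_project:
  assumes "finite K" "constructible S"
  shows "constructible {x. \<exists>z. override_on x z K \<in> S}"
  using assms(1)
proof induction
  case empty
  then show ?case using assms(2) by simp
next
  case (insert k K)
  have "(\<exists>z. override_on x z (insert k K) \<in> S) \<longleftrightarrow> (\<exists>t z. override_on (x(k := t)) z K \<in> S)" for x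
  proof
    assume "\<exists>z. override_on x z (insert k K) \<in> S"
    then obtain z where "override_on x z (insert k K) \<in> S" ..
    moreover have "override_on x z (insert k K) = override_on (x(k := z k)) z K"
      by (auto simp: override_on_def)
    ultimately show "\<exists>t z. override_on (x(k := t)) z K \<in> S" by auto
  next
    assume "\<exists>t z. override_on (x(k := t)) z K \<in> S"
    then obtain t z where "override_on (x(k := t)) z K \<in> S" by auto
    moreover have "override_on (x(k := t)) z K = override_on x (z(k := t)) (insert k K)"
      using insert by (auto simp: override_on_def)
    ultimately show "\<exists>z. override_on x z (insert k K) \<in> S" by auto
  qed
  then show ?case using constructible_project_one[OF insert.IH, of k] by simp
qed

section \<open>Algebraic dependence\<close>

text \<open>Gaussian elimination: an unknown \<open>p\<close> that occurs in equation
\<open>j\<close> is eliminated from the other equations, and its value is chosen in the end so that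
equation \<open>j\<close> holds.\<close>

lemma homogeneous_system_nontrivial:
  fixes M :: "'i \<Rightarrow> 'j \<Rightarrow> 'a::field"
  assumes "finite J" "finite I" "card J < card I"
  shows "\<exists>c. (\<exists>i\<in>I. c i \<noteq> 0) \<and> (\<forall>j\<in>J. (\<Sum>i\<in>I. c i * M i j) = 0)"
  using assms
proof (induction J arbitrary: I M rule: finite_induct)
  case empty
  then have "I \<noteq> {}" by auto
  then show ?case by (intro exI[of _ "\<lambda>_. 1"]) auto
next
  case (insert j J)
  show ?case
  proof (cases "\<forall>i\<in>I. M i j = 0")
    case True
    have "card J < card I" using insert by simp
    from insert.IH[OF insert.prems(1) this] obtain c
      where "\<exists>i\<in>I. c i \<noteq> 0" "\<forall>j\<in>J. (\<Sum>i\<in>I. c i * M i j) = 0" by blast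
    then show ?thesis using True by (intro exI[of _ c]) simp
  next
    case False
    then obtain p where p: "p \<in> I" "M p j \<noteq> 0" by blast
    define M' where "M' i k = M i k - M i j / M p j * M p k" for i k
    have "card J < card (I - {p})" using insert p by simp
    from insert.IH[OF _ this, of M'] insert.prems obtain c
      where c: "\<exists>i\<in>I - {p}. c i \<noteq> 0" "\<forall>k\<in>J. (\<Sum>i\<in>I - {p}. c i * M' i k) = 0" by blast
    define b where "b = (\<Sum>i\<in>I - {p}. c i * M i j) / M p j"
    define c' where "c' = c(p := - b)"
    have split: "(\<Sum>i\<in>I. c' i * M i k) = (\<Sum>i\<in>I - {p}. c i * M i k) - b * M p k" for k
      using p insert.prems by (simp add: sum.remove[of I p] c'_def)
    have "(\<Sum>i\<in>I. c' i * M i k) = 0" if "k \<in> J" for k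
    proof -
      have "(\<Sum>i\<in>I - {p}. c i * M' i k) = (\<Sum>i\<in>I - {p}. c i * M i k) - b * M p k"
        unfolding M'_def b_def
        by (simp add: right_diff_distrib sum_subtractf sum_divide_distrib sum_distrib_right mult.assoc)
      then show ?thesis using c(2) that by (simp add: split)
    qed
    moreover have "(\<Sum>i\<in>I. c' i * M i j) = 0" unfolding split b_def using p by simp
    moreover have "\<exists>i\<in>I. c' i \<noteq> 0" using c(1) by (auto simp: c'_def)
    ultimately show ?thesis by (intro exI[of _ c']) simp
  qed
qed

text \<open>The degree in one variable, as a property of the function rather than of an expression
for it. This makes the rules for sums and products immediate.\<close>

definition degree_in_le :: "'v \<Rightarrow> nat \<Rightarrow> (('v \<Rightarrow> complex) \<Rightarrow> complex) \<Rightarrow> bool" where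
  "degree_in_le v E p \<longleftrightarrow> (\<forall>x. \<exists>q. degree q \<le> E \<and> (\<forall>t. p (x(v := t)) = poly q t))"

lemma degree_in_le_const: "degree_in_le v E (\<lambda>x. c)"
  unfolding degree_in_le_def by (intro allI exI[of _ "[:c:]"]) simp

lemma degree_in_le_var: "degree_in_le v 1 (\<lambda>x. x w)"
  unfolding degree_in_le_def
proof
  fix x :: "'a \<Rightarrow> complex"
  show "\<exists>q. degree q \<le> 1 \<and> (\<forall>t. (x(v := t)) w = poly q t)"
    by (rule exI[of _ "if w = v then [:0, 1:] else [:x w:]"]) simp
qed

lemma degree_in_le_add:
  assumes "degree_in_le v E p" "degree_in_le v E q"
  shows "degree_in_le v E (\<lambda>x. p x + q x)"
  unfolding degree_in_le_def
proof
  fix x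
  obtain f where f: "degree f \<le> E" "\<forall>t. p (x(v := t)) = poly f t"
    using assms(1) unfolding degree_in_le_def by blast
  obtain g where g: "degree g \<le> E" "\<forall>t. q (x(v := t)) = poly g t"
    using assms(2) unfolding degree_in_le_def by blast
  show "\<exists>h. degree h \<le> E \<and> (\<forall>t. p (x(v := t)) + q (x(v := t)) = poly h t)"
    using f(2) g(2) degree_add_le[OF f(1) g(1)]
    by (intro exI[of _ "f + g"]) (simp del: fun_upd_apply)
qed

lemma degree_in_le_mult:
  assumes "degree_in_le v D p" "degree_in_le v E q"
  shows "degree_in_le v (D + E) (\<lambda>x. p x * q x)"
  unfolding degree_in_le_def
proof
  fix x
  obtain f where f: "degree f \<le> D" "\<forall>t. p (x(v := t)) = poly f t"
    using assms(1) unfolding degree_in_le_def by blast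
  obtain g where g: "degree g \<le> E" "\<forall>t. q (x(v := t)) = poly g t"
    using assms(2) unfolding degree_in_le_def by blast
  show "\<exists>h. degree h \<le> D + E \<and> (\<forall>t. p (x(v := t)) * q (x(v := t)) = poly h t)"
    using f(2) g(2) order_trans[OF degree_mult_le add_mono[OF f(1) g(1)]]
    by (intro exI[of _ "f * g"]) (simp del: fun_upd_apply)
qed

lemma degree_in_le_sum:
  "(\<And>i. i \<in> I \<Longrightarrow> degree_in_le v E (p i)) \<Longrightarrow> degree_in_le v E (\<lambda>x. \<Sum>i\<in>I. p i x)"
  by (induction I rule: infinite_finite_induct) (auto intro: degree_in_le_const degree_in_le_add)

lemma degree_in_le_prod:
  assumes "finite I" "\<And>i. i \<in> I \<Longrightarrow> degree_in_le v E (p i)"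
  shows "degree_in_le v (card I * E) (\<lambda>x. \<Prod>i\<in>I. p i x)"
  using assms
proof (induction I rule: finite_induct)
  case empty
  then show ?case by (simp add: degree_in_le_const)
next
  case (insert i I)
  then have "degree_in_le v (E + card I * E) (\<lambda>x. p i x * (\<Prod>i\<in>I. p i x))"
    by (intro degree_in_le_mult) auto
  with insert show ?case by simp
qed

text \<open>One variable at a time is freed from the grid: a polynomial in one variable of degree at
most \<open>E\<close> that vanishes at the \<open>E + 1\<close> points \<open>0, \<dots>, E\<close>
is zero.\<close>

lemma zero_on_grid_imp_zero:
  assumes "finite A" "\<And>a. a \<in> A \<Longrightarrow> degree_in_le a E p"
    and "\<And>x. (\<And>a. a \<in> A \<Longrightarrow> x a \<in> of_nat ` {..E}) \<Longrightarrow> p x = 0"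
  shows "p x = 0"
  using assms
proof (induction A arbitrary: x rule: finite_induct)
  case empty
  then show ?case by simp
next
  case (insert a A)
  show ?case
  proof (rule insert.IH)
    fix x :: "'a \<Rightarrow> complex" assume x: "\<And>a. a \<in> A \<Longrightarrow> x a \<in> of_nat ` {..E}"
    obtain q where q: "degree q \<le> E" "\<forall>t. p (x(a := t)) = poly q t"
      using insert.prems(1)[of a] unfolding degree_in_le_def by blast
    have "q = 0"
    proof (rule poly_eqI_degree[where A = "of_nat ` {..E}"])
      fix t :: complex assume t: "t \<in> of_nat ` {..E}"
      have "p (x(a := t)) = 0"
      proof (rule insert.prems(2))
        fix b assume "b \<in> insert a A"
        then show "(x(a := t)) b \<in> of_nat ` {..E}" using t x[of b] by (cases "b = a") auto
      qed
      then show "poly q t = poly 0 t" using q(2) by simp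
    qed (use q(1) in \<open>simp_all add: card_image inj_on_def\<close>)
    then have "p (x(a := x a)) = 0" using q(2) by (metis poly_0)
    then show "p x = 0" by simp
  qed (use insert.prems(1) in auto)
qed

text \<open>More polynomials than variables are algebraically dependent. Grids replace monomials on
both sides of the count: the candidates for the relation are combinations of the Lagrange
polynomials \<open>L g\<close> of the grid \<open>{0..s}\<close> to the power \<open>I\<close>,
which gives \<open>(s + 1) ^ card I\<close> unknowns and makes their independence evident;
substitution of \<open>\<phi>\<close> gives degree at most \<open>E\<close> in every variable, so it
is enough to have zeros on the grid \<open>{0..E}\<close> to the power \<open>A\<close>, which gives
\<open>(E + 1) ^ card A\<close> equations. As \<open>E\<close> is linear in \<open>s\<close>, the
unknowns win for large \<open>s\<close>. The conclusion is about all \<open>y\<close> that agree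
with \<open>\<phi>\<close> on \<open>I\<close> because \<open>Q\<close> will be applied to points
that have further, arbitrary coordinates.\<close>

lemma algebraic_relation:
  fixes \<phi> :: "'i \<Rightarrow> ('v \<Rightarrow> complex) \<Rightarrow> complex"
  assumes fin: "finite I" "finite A" and card: "card A < card I"
    and deg: "\<And>i a. i \<in> I \<Longrightarrow> a \<in> A \<Longrightarrow> degree_in_le a d (\<phi> i)"
    and dep: "\<And>i x y. i \<in> I \<Longrightarrow> (\<And>a. a \<in> A \<Longrightarrow> x a = y a) \<Longrightarrow> \<phi> i x = \<phi> i y"
  shows "\<exists>Q. polyfun Q \<and> (\<exists>y. Q y \<noteq> 0) \<and> (\<forall>y x. (\<forall>i\<in>I. y i = \<phi> i x) \<longrightarrow> Q y = 0)"
proof -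
  \<comment> \<open>Since \<open>E + 1 \<le> (card I * d + 1) * (s + 1)\<close>, the number of equations is at most
      \<open>(card I * d + 1) ^ card A * (s + 1) ^ card A\<close>, so the first factor must stay below \<open>s + 1\<close>.\<close>
  define s where "s = (card I * d + 1) ^ card A"
  define E where "E = card I * (s * d)"
  define G where "G = I \<rightarrow>\<^sub>E {..s}"
  define H where "H = A \<rightarrow>\<^sub>E {..E}"
  define L :: "('i \<Rightarrow> nat) \<Rightarrow> ('i \<Rightarrow> complex) \<Rightarrow> complex"
    where "L g y = (\<Prod>i\<in>I. \<Prod>j\<in>{..s} - {g i}. y i - of_nat j)" for g y
  define pt :: "('v \<Rightarrow> nat) \<Rightarrow> 'v \<Rightarrow> complex" where "pt h a = of_nat (h a)" for h a
  have "card H < card G"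
  proof -
    have "E + 1 \<le> (card I * d + 1) * (s + 1)" by (simp add: E_def)
    then have "(E + 1) ^ card A \<le> ((card I * d + 1) * (s + 1)) ^ card A" by (rule power_mono) simp
    also have "\<dots> = s * (s + 1) ^ card A" by (simp only: power_mult_distrib s_def)
    also have "\<dots> < (s + 1) ^ Suc (card A)" by simp
    also have "\<dots> \<le> (s + 1) ^ card I" using card by (intro power_increasing) auto
    finally show ?thesis using fin by (simp add: G_def H_def card_PiE)
  qed
  moreover have "finite G" "finite H" using fin by (auto simp: G_def H_def intro: finite_PiE)
  ultimately obtain c where c: "\<exists>g\<in>G. c g \<noteq> 0"
      and eqs: "\<forall>h\<in>H. (\<Sum>g\<in>G. c g * L g (\<lambda>i. \<phi> i (pt h))) = 0"
    using homogeneous_system_nontrivial[of H G "\<lambda>g h. L g (\<lambda>i. \<phi> i (pt h))"] by blast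
  define Q where "Q y = (\<Sum>g\<in>G. c g * L g y)" for y
  have "polyfun Q"
    unfolding Q_def L_def
    by (intro polyfun_sum polyfun.mult polyfun.const polyfun_prod polyfun_diff polyfun.var)
  moreover have "\<exists>y. Q y \<noteq> 0"
  proof -
    obtain g0 where g0: "g0 \<in> G" "c g0 \<noteq> 0" using c by blast
    have "L g (\<lambda>i. of_nat (g0 i)) = 0" if "g \<in> G" "g \<noteq> g0" for g
    proof -
      have "\<exists>i\<in>I. g i \<noteq> g0 i"
        using that g0(1) PiE_ext[of g I "\<lambda>_. {..s}" g0] unfolding G_def by blast
      then obtain i where i: "i \<in> I" "g i \<noteq> g0 i" by blast
      then have "g0 i \<in> {..s} - {g i}" using g0(1) by (auto simp: G_def)
      then have "(\<Prod>j\<in>{..s} - {g i}. of_nat (g0 i) - complex_of_nat j) = 0"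
        by (intro prod_zero) auto
      then show ?thesis unfolding L_def using i(1) fin by (intro prod_zero) auto
    qed
    then have "Q (\<lambda>i. of_nat (g0 i)) = c g0 * L g0 (\<lambda>i. of_nat (g0 i))"
      unfolding Q_def using g0(1) \<open>finite G\<close> by (simp add: sum.remove[of G g0])
    moreover have "L g0 (\<lambda>i. of_nat (g0 i)) \<noteq> 0"
      unfolding L_def using fin by auto
    ultimately show ?thesis using g0(2) by (intro exI[of _ "\<lambda>i. of_nat (g0 i)"]) simp
  qed
  moreover have "Q y = 0" if y: "\<forall>i\<in>I. y i = \<phi> i x" for y and x :: "'v \<Rightarrow> complex"
  proof -
    have "(\<Sum>g\<in>G. c g * L g (\<lambda>i. \<phi> i x)) = 0"
    proof (rule zero_on_grid_imp_zero[OF fin(2), of E "\<lambda>x. \<Sum>g\<in>G. c g * L g (\<lambda>i. \<phi> i x)"])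
      fix a assume a: "a \<in> A"
      have fac: "degree_in_le a d (\<lambda>x. \<phi> i x - of_nat j)" if "i \<in> I" for i j
        using degree_in_le_add[OF deg[OF that a] degree_in_le_const[of a d "- of_nat j"]] by simp
      have row: "degree_in_le a (s * d) (\<lambda>x. \<Prod>j\<in>{..s} - {g i}. \<phi> i x - of_nat j)"
        if "g \<in> G" "i \<in> I" for g i
      proof -
        have "card ({..s} - {g i}) = s" using that by (auto simp: G_def PiE_iff)
        then show ?thesis
          using degree_in_le_prod[of "{..s} - {g i}" a d "\<lambda>j x. \<phi> i x - of_nat j", OF _ fac[OF that(2)]]
          by simp
      qed
      have "degree_in_le a E (\<lambda>x. L g (\<lambda>i. \<phi> i x))" if "g \<in> G" for g
        unfolding L_def E_def by (rule degree_in_le_prod[OF fin(1) row[OF that]])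
      then have "degree_in_le a (0 + E) (\<lambda>x. c g * L g (\<lambda>i. \<phi> i x))" if "g \<in> G" for g
        using that by (intro degree_in_le_mult degree_in_le_const)
      then show "degree_in_le a E (\<lambda>x. \<Sum>g\<in>G. c g * L g (\<lambda>i. \<phi> i x))"
        by (intro degree_in_le_sum) simp
    next
      fix x :: "'v \<Rightarrow> complex" assume x: "\<And>a. a \<in> A \<Longrightarrow> x a \<in> of_nat ` {..E}"
      then have "\<forall>a\<in>A. \<exists>k. k \<le> E \<and> x a = of_nat k" by auto
      from bchoice[OF this] obtain k where k: "\<And>a. a \<in> A \<Longrightarrow> k a \<le> E \<and> x a = of_nat (k a)" by blast
      define h where "h = restrict k A"
      have "h \<in> H" using k by (auto simp: h_def H_def)
      have "L g (\<lambda>i. \<phi> i x) = L g (\<lambda>i. \<phi> i (pt h))" for g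
        unfolding L_def
      proof (intro prod.cong refl)
        fix i j assume "i \<in> I"
        then have "\<phi> i x = \<phi> i (pt h)" by (rule dep) (simp add: pt_def h_def k)
        then show "\<phi> i x - of_nat j = \<phi> i (pt h) - of_nat j" by simp
      qed
      then show "(\<Sum>g\<in>G. c g * L g (\<lambda>i. \<phi> i x)) = 0" using eqs \<open>h \<in> H\<close> by simp
    qed
    moreover have "L g y = L g (\<lambda>i. \<phi> i x)" for g
      unfolding L_def using y by (intro prod.cong refl) simp
    ultimately show ?thesis by (simp add: Q_def)
  qed
  ultimately show ?thesis by blast
qed

section \<open>Powers of linear forms\<close>

lemma mdeg_superset:
  assumes "finite A" "Poly_Mapping.keys m \<subseteq> A"
  shows "mdeg m = (\<Sum>v\<in>A. Poly_Mapping.lookup m v)"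
  unfolding mdeg_def
  by (rule sum.mono_neutral_left) (use assms in \<open>auto simp: in_keys_iff\<close>)

lemma mdeg_add: "mdeg (m + m') = mdeg m + mdeg m'"
proof -
  let ?A = "Poly_Mapping.keys m \<union> Poly_Mapping.keys m'"
  have "mdeg (m + m') = (\<Sum>v\<in>?A. Poly_Mapping.lookup (m + m') v)"
    by (rule mdeg_superset) (auto simp: in_keys_iff lookup_add)
  also have "\<dots> = mdeg m + mdeg m'"
    by (simp add: lookup_add sum.distrib mdeg_superset[of ?A m] mdeg_superset[of ?A m'])
  finally show ?thesis .
qed

lemma mdeg_single [simp]: "mdeg (Poly_Mapping.single v k) = k"
  by (simp add: mdeg_def)

lemma mdeg_zero [simp]: "mdeg 0 = 0"
  by (simp add: mdeg_def)

lemma mdeg_eq_0_iff [simp]: "mdeg m = 0 \<longleftrightarrow> m = 0"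
proof
  assume "mdeg m = 0"
  then have "\<forall>v\<in>Poly_Mapping.keys m. Poly_Mapping.lookup m v = 0" by (simp add: mdeg_def)
  then show "m = 0" by (auto simp: in_keys_iff intro!: poly_mapping_eqI)
qed simp

lemma monom_remove_variable:
  fixes m :: "'v monom"
  assumes "v \<in> Poly_Mapping.keys m"
  shows "\<exists>m'. m = m' + Poly_Mapping.single v 1"
proof (rule exI)
  show "m = (m - Poly_Mapping.single v 1) + Poly_Mapping.single v 1"
    using assms by (intro poly_mapping_eqI)
      (auto simp: lookup_add lookup_minus lookup_single in_keys_iff when_def)
qed

lemma mdeg_eq_1E:
  assumes "mdeg m = 1"
  obtains v where "m = Poly_Mapping.single v 1"
proof -
  have "m \<noteq> 0" using assms by auto
  then have "Poly_Mapping.keys m \<noteq> {}" by simp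
  then obtain v where "v \<in> Poly_Mapping.keys m" by blast
  from monom_remove_variable[OF this] obtain m' where m': "m = m' + Poly_Mapping.single v 1" ..
  then have "mdeg m' = 0" using assms by (simp add: mdeg_add)
  with m' show thesis using that by simp
qed

text \<open>Expanding a power of a sum without collecting terms indexes the summands by words
\<open>f\<close> of length \<open>d\<close> in the variables. Summation over words avoids
multinomial coefficients: all that matters below is that every monomial of degree \<open>d\<close>
comes from at least one word.\<close>

definition word_monom :: "nat \<Rightarrow> (nat \<Rightarrow> 'v) \<Rightarrow> 'v monom" where
  "word_monom d f = (\<Sum>j<d. Poly_Mapping.single (f j) 1)"

lemma word_monom_Suc: "word_monom (Suc d) f = word_monom d f + Poly_Mapping.single (f d) 1"
  by (simp add: word_monom_def)

lemma mdeg_word_monom [simp]: "mdeg (word_monom d f) = d"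
  by (induction d) (simp_all add: word_monom_Suc mdeg_add, simp add: word_monom_def)

lemma keys_word_monom:
  assumes "f \<in> {..<d} \<rightarrow> A"
  shows "Poly_Mapping.keys (word_monom d f) \<subseteq> A"
proof -
  have "Poly_Mapping.keys (word_monom d f) \<subseteq> (\<Union>j<d. Poly_Mapping.keys (Poly_Mapping.single (f j) (1::nat)))"
    unfolding word_monom_def by (rule keys_sum)
  then show ?thesis using assms by (auto split: if_splits)
qed

lemma eval_word_monom: "eval_monom (word_monom d f) c = (\<Prod>j<d. c (f j))"
proof (induction d)
  case 0
  show ?case by (simp add: word_monom_def)
next
  case (Suc d)
  have "eval_monom (Poly_Mapping.single (f d) 1) c = c (f d)" by (simp add: eval_monom_def)
  with Suc show ?case by (simp add: word_monom_Suc eval_monom_add)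
qed

lemma word_monom_surj:
  "mdeg a = d \<Longrightarrow> \<exists>f\<in>{..<d} \<rightarrow>\<^sub>E Poly_Mapping.keys a. word_monom d f = a"
proof (induction d arbitrary: a)
  case 0
  then show ?case by (auto simp: word_monom_def)
next
  case (Suc d)
  then have "a \<noteq> 0" by auto
  then have "Poly_Mapping.keys a \<noteq> {}" by simp
  then obtain v where v: "v \<in> Poly_Mapping.keys a" by blast
  from monom_remove_variable[OF this] obtain b where b: "a = b + Poly_Mapping.single v 1" ..
  then have "mdeg b = d" using Suc.prems by (simp add: mdeg_add)
  then obtain f where f: "f \<in> {..<d} \<rightarrow>\<^sub>E Poly_Mapping.keys b" "word_monom d f = b"
    using Suc.IH by blast
  have sub: "Poly_Mapping.keys b \<subseteq> Poly_Mapping.keys a"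
    by (auto simp: b in_keys_iff lookup_add)
  have "word_monom d (f(d := v)) = word_monom d f"
    unfolding word_monom_def by (rule sum.cong) auto
  then have "word_monom (Suc d) (f(d := v)) = a"
    by (simp add: word_monom_Suc f(2) b)
  moreover have "f(d := v) \<in> {..<Suc d} \<rightarrow>\<^sub>E Poly_Mapping.keys a"
    using f(1) v sub by (auto simp: PiE_iff extensional_def less_Suc_eq)
  ultimately show ?case by blast
qed

definition linform :: "'v set \<Rightarrow> ('v \<Rightarrow> complex) \<Rightarrow> 'v cpoly" where
  "linform A c = (\<Sum>v\<in>A. Poly_Mapping.single (Poly_Mapping.single v 1) (c v))"

lemma prod_single:
  "(\<Prod>j\<in>J. Poly_Mapping.single (m j) (c j)) =
   Poly_Mapping.single (\<Sum>j\<in>J. m j :: 'v monom) (\<Prod>j\<in>J. c j :: complex)"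
  by (induction J rule: infinite_finite_induct) (auto simp: mult_single)

lemma linform_power:
  assumes "finite A"
  shows "linform A c ^ d =
    (\<Sum>f\<in>{..<d} \<rightarrow>\<^sub>E A. Poly_Mapping.single (word_monom d f) (eval_monom (word_monom d f) c))"
proof -
  have "linform A c ^ d = (\<Prod>j<d. \<Sum>v\<in>A. Poly_Mapping.single (Poly_Mapping.single v 1) (c v))"
    by (simp add: linform_def)
  also have "\<dots> = (\<Sum>f\<in>{..<d} \<rightarrow>\<^sub>E A. \<Prod>j<d. Poly_Mapping.single (Poly_Mapping.single (f j) 1) (c (f j)))"
    by (rule prod_sum_PiE) (use assms in auto)
  also have "\<dots> = (\<Sum>f\<in>{..<d} \<rightarrow>\<^sub>E A. Poly_Mapping.single (word_monom d f) (eval_monom (word_monom d f) c))"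
    unfolding eval_word_monom prod_single word_monom_def[symmetric] ..
  finally show ?thesis .
qed

lemma linform_in_forms: "A \<subseteq> {1..n} \<Longrightarrow> linform A c \<in> forms n 1"
proof -
  assume A: "A \<subseteq> {1..n}"
  have "Poly_Mapping.keys (linform A c) \<subseteq>
      (\<Union>v\<in>A. Poly_Mapping.keys (Poly_Mapping.single (Poly_Mapping.single v (1::nat)) (c v)))"
    unfolding linform_def by (rule keys_sum)
  also have "\<dots> \<subseteq> (\<lambda>v. Poly_Mapping.single v 1) ` A" by (auto split: if_splits)
  finally show ?thesis using A by (fastforce simp: forms_def)
qed

lemma forms_1E:
  assumes "l \<in> forms n 1"
  obtains c where "l = linform {1..n} c"
proof -
  define c where "c v = Poly_Mapping.lookup l (Poly_Mapping.single v 1)" for v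
  have "l = linform {1..n} c"
  proof (rule poly_mapping_eqI)
    fix m
    show "Poly_Mapping.lookup l m = Poly_Mapping.lookup (linform {1..n} c) m"
    proof (cases "\<exists>v\<in>{1..n}. m = Poly_Mapping.single v 1")
      case True
      then obtain v where v: "v \<in> {1..n}" "m = Poly_Mapping.single v 1" by blast
      have "Poly_Mapping.single w 1 = Poly_Mapping.single v (1::nat) \<longleftrightarrow> w = v" for w
        by (metis lookup_single_eq lookup_single_not_eq zero_neq_one)
      with v show ?thesis
        by (simp add: linform_def lookup_sum lookup_single when_def c_def)
    next
      case False
      have "m \<notin> Poly_Mapping.keys l"
      proof
        assume "m \<in> Poly_Mapping.keys l"
        then have "Poly_Mapping.keys m \<subseteq> {1..n}" "mdeg m = 1" using assms by (auto simp: forms_def)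
        then show False using False by (elim mdeg_eq_1E) auto
      qed
      moreover have "Poly_Mapping.lookup (linform {1..n} c) m = 0"
        using False by (auto simp: linform_def lookup_sum lookup_single when_def intro!: sum.neutral)
      ultimately show ?thesis by (simp add: in_keys_iff)
    qed
  qed
  then show thesis by (rule that)
qed

section \<open>Sums of powers and the Waring rank\<close>

text \<open>The constants \<open>c i\<close> of a Waring decomposition are absorbed into the linear
forms, as complex numbers have \<open>d\<close>-th roots. For the lower bound on the generic rank
this matters: each term contributes \<open>n\<close> parameters and not \<open>n +
1\<close>.\<close>

definition power_sum :: "nat \<Rightarrow> nat \<Rightarrow> nat \<Rightarrow> nat cpoly \<Rightarrow> bool" where
  "power_sum n d r F \<longleftrightarrow> (\<exists>l. (\<forall>i<r. l i \<in> forms n 1) \<and> F = (\<Sum>i<r. l i ^ d))"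

lemma single_0_power: "Poly_Mapping.single 0 z ^ d = Poly_Mapping.single (0::'v monom) (z ^ d :: complex)"
  by (induction d) (auto simp: mult_single)

lemma scaled_linear_form:
  assumes "l \<in> forms n 1" "d > 0"
  shows "\<exists>l'\<in>forms n 1. Poly_Mapping.single 0 c * l ^ d = l' ^ d"
proof -
  obtain z where z: "c = z ^ d" using exists_complex_root[of d c] assms(2) by auto
  obtain b where "l = linform {1..n} b" using assms(1) by (rule forms_1E)
  then have "Poly_Mapping.single 0 z * l = linform {1..n} (\<lambda>v. z * b v)"
    by (simp add: linform_def sum_distrib_left mult_single)
  then have "Poly_Mapping.single 0 z * l \<in> forms n 1" using linform_in_forms[of "{1..n}" n] by simp
  moreover have "Poly_Mapping.single 0 c * l ^ d = (Poly_Mapping.single 0 z * l) ^ d"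
    by (simp add: z power_mult_distrib single_0_power)
  ultimately show ?thesis by blast
qed

lemma power_sumI:
  assumes "finite I" "\<And>i. i \<in> I \<Longrightarrow> l i \<in> forms n 1" "d > 0"
  shows "power_sum n d (card I) (\<Sum>i\<in>I. Poly_Mapping.single 0 (c i) * l i ^ d)"
proof -
  have "\<forall>i\<in>I. \<exists>l'. l' \<in> forms n 1 \<and> Poly_Mapping.single 0 (c i) * l i ^ d = l' ^ d"
    using scaled_linear_form assms(2,3) by blast
  then obtain l' where l': "\<And>i. i \<in> I \<Longrightarrow> l' i \<in> forms n 1"
      "\<And>i. i \<in> I \<Longrightarrow> Poly_Mapping.single 0 (c i) * l i ^ d = l' i ^ d"
    using bchoice[of I] by metis
  obtain h where h: "bij_betw h {..<card I} I"
    using ex_bij_betw_nat_finite[OF assms(1)] by (auto simp: atLeast0LessThan)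
  have "(\<Sum>i\<in>I. Poly_Mapping.single 0 (c i) * l i ^ d) = (\<Sum>i\<in>I. l' i ^ d)"
    by (rule sum.cong) (auto simp: l')
  also have "\<dots> = (\<Sum>j<card I. l' (h j) ^ d)"
    by (rule sum.reindex_bij_betw[OF h, symmetric])
  finally show ?thesis
    unfolding power_sum_def using l'(1) bij_betwE[OF h] by (intro exI[of _ "\<lambda>j. l' (h j)"]) auto
qed

lemma waring_rank_eq:
  assumes "d > 0"
  shows "waring_rank n d F = (LEAST r. power_sum n d r F)"
proof -
  have "(\<exists>c l. (\<forall>i<r. l i \<in> forms n 1) \<and> F = (\<Sum>i<r. Poly_Mapping.single 0 (c i) * l i ^ d)) \<longleftrightarrow>
        power_sum n d r F" (is "?L \<longleftrightarrow> _") for r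
  proof
    assume ?L
    then show "power_sum n d r F" using power_sumI[of "{..<r}", OF _ _ assms] by force
  next
    assume "power_sum n d r F"
    then obtain l where "\<forall>i<r. l i \<in> forms n 1" "F = (\<Sum>i<r. l i ^ d)"
      unfolding power_sum_def by blast
    then show ?L by (intro exI[of _ "\<lambda>i. 1"] exI[of _ l]) simp
  qed
  then show ?thesis unfolding waring_rank_def by simp
qed

lemma power_sum_mono:
  assumes "power_sum n d r F" "r \<le> s" "d > 0"
  shows "power_sum n d s F"
proof -
  obtain l where l: "\<forall>i<r. l i \<in> forms n 1" "F = (\<Sum>i<r. l i ^ d)"
    using assms(1) unfolding power_sum_def by blast
  define l' where "l' i = (if i < r then l i else 0)" for i
  have "(\<Sum>i<s. l' i ^ d) = (\<Sum>i<r. l' i ^ d)"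
    using assms(2,3) by (intro sum.mono_neutral_right) (auto simp: l'_def)
  also have "\<dots> = F" by (simp add: l(2) l'_def)
  finally have "F = (\<Sum>i<s. l' i ^ d)" ..
  moreover have "0 \<in> forms n 1" by (simp add: forms_def)
  ultimately show ?thesis
    unfolding power_sum_def using l(1) by (intro exI[of _ l']) (auto simp: l'_def)
qed

lemma power_sum_add:
  assumes "power_sum n d r F" "power_sum n d s G"
  shows "power_sum n d (r + s) (F + G)"
proof -
  obtain l where l: "\<forall>i<r. l i \<in> forms n 1" "F = (\<Sum>i<r. l i ^ d)"
    using assms(1) unfolding power_sum_def by blast
  obtain k where k: "\<forall>i<s. k i \<in> forms n 1" "G = (\<Sum>i<s. k i ^ d)"
    using assms(2) unfolding power_sum_def by blast
  have "F + G = (\<Sum>i<r + s. (if i < r then l i else k (i - r)) ^ d)"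
  proof -
    have "(\<Sum>i<r + s. h i) = (\<Sum>i<r. h i) + (\<Sum>i<s. h (r + i))" for h :: "nat \<Rightarrow> nat cpoly"
      by (induction s) (simp_all add: add.assoc)
    then show ?thesis by (simp add: l(2) k(2))
  qed
  then show ?thesis
    unfolding power_sum_def using l(1) k(1)
    by (intro exI[of _ "\<lambda>i. if i < r then l i else k (i - r)"]) auto
qed

section \<open>Decomposition of monomials\<close>

lemma sum_roots_of_unity:
  assumes "k > 0"
  defines "w \<equiv> exp (2 * of_real pi * \<i> / of_nat k)"
  shows "(\<Sum>e<k. w ^ (e * j)) = (if k dvd j then of_nat k else 0)"
proof -
  have wj: "w ^ j = exp (2 * of_real pi * \<i> * of_nat j / of_nat k)" for j
    unfolding w_def by (simp flip: exp_of_nat_mult add: mult_ac)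
  have one: "w ^ j = 1 \<longleftrightarrow> k dvd j" for j
    unfolding wj using complex_root_unity_eq_1[of k j] assms(1) by simp
  have "(\<Sum>e<k. w ^ (e * j)) = (\<Sum>e<k. (w ^ j) ^ e)"
    by (simp add: power_mult mult.commute flip: power_mult)
  also have "\<dots> = (if k dvd j then of_nat k else 0)"
  proof (cases "k dvd j")
    case True
    then have "w ^ j = 1" using one by simp
    with True show ?thesis by simp
  next
    case False
    have "(w ^ j) ^ k = 1" using one[of "j * k"] by (simp add: power_mult)
    then show ?thesis using False one[of j] by (simp add: geometric_sum)
  qed
  finally show ?thesis .
qed

text \<open>Multiply the linear forms \<open>x\<^sub>u + \<Sum>\<^sub>v \<zeta>\<^sub>v
x\<^sub>v\<close>, raised to the power \<open>d\<close>, by \<open>\<Prod>\<^sub>v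
\<zeta>\<^sub>v\<close> and add over all choices of roots of unity \<open>\<zeta>\<^sub>v\<close> of
order dividing \<open>a\<^sub>v + 1\<close>. A monomial with exponents \<open>b\<close> survives
only if \<open>a\<^sub>v + 1\<close> divides \<open>b\<^sub>v + 1\<close> for all \<open>v \<noteq>
u\<close>, hence \<open>b\<^sub>v = a\<^sub>v\<close> or \<open>b\<^sub>v > a\<^sub>v + a\<^sub>v
\<ge> a\<^sub>v + a\<^sub>u\<close>. If the second case occurred for some \<open>v\<close>, the
degree of the monomial would exceed \<open>d\<close>, because the other exponents are still at least
those of \<open>a\<close>. So only the monomial \<open>a\<close> is left. It is here that
\<open>a\<^sub>u\<close> has to be the least positive exponent.\<close>

lemma power_sum_monomial:
  fixes a :: "nat monom"
  assumes keys: "Poly_Mapping.keys a \<subseteq> {1..n}" and d: "mdeg a = d" and u: "u \<in> Poly_Mapping.keys a"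
    and min: "\<And>v. v \<in> Poly_Mapping.keys a \<Longrightarrow> Poly_Mapping.lookup a u \<le> Poly_Mapping.lookup a v"
  shows "power_sum n d (\<Prod>v\<in>Poly_Mapping.keys a - {u}. Poly_Mapping.lookup a v + 1) (Poly_Mapping.single a 1)"
proof -
  define S where "S = Poly_Mapping.keys a"
  define T where "T = S - {u}"
  define k where "k v = Poly_Mapping.lookup a v + 1" for v
  define w where "w v = exp (2 * of_real pi * \<i> / of_nat (k v))" for v
  define I where "I = PiE T (\<lambda>v. {..<k v})"
  define z where "z e v = (if v \<in> T then w v ^ e v else 1)" for e :: "nat \<Rightarrow> nat" and v
  define c where "c e = (\<Prod>v\<in>T. w v ^ e v)" for e :: "nat \<Rightarrow> nat"
  define P where "P = (\<Prod>v\<in>T. complex_of_nat (k v))"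
  have [simp]: "finite S" "finite T" "finite I" by (auto simp: S_def T_def I_def intro: finite_PiE)
  have S: "S = insert u T" "u \<notin> T" using u by (auto simp: T_def S_def)
  have kpos: "k v > 0" for v by (simp add: k_def)
  have cardI: "card I = (\<Prod>v\<in>T. k v)" by (simp add: I_def card_PiE)
  have "d > 0" using d u by (metis gr0I keys_zero mdeg_eq_0_iff empty_iff)
  have coeff: "(\<Sum>e\<in>I. c e * eval_monom b (z e)) = (if b = a then P else 0)"
    if b: "Poly_Mapping.keys b \<subseteq> S" "mdeg b = d" for b
  proof -
    have "c e * eval_monom b (z e) = (\<Prod>v\<in>T. w v ^ (e v * (Poly_Mapping.lookup b v + 1)))" for e
    proof -
      have "eval_monom b (z e) = (\<Prod>v\<in>S. z e v ^ Poly_Mapping.lookup b v)"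
        by (rule eval_monom_superset) (use b in auto)
      also have "\<dots> = (\<Prod>v\<in>T. (w v ^ e v) ^ Poly_Mapping.lookup b v)"
        using S by (simp add: z_def)
      finally show ?thesis
        by (simp add: c_def power_mult power_add flip: prod.distrib)
    qed
    then have "(\<Sum>e\<in>I. c e * eval_monom b (z e)) =
        (\<Sum>e\<in>I. \<Prod>v\<in>T. w v ^ (e v * (Poly_Mapping.lookup b v + 1)))" by simp
    also have "\<dots> = (\<Prod>v\<in>T. \<Sum>j<k v. w v ^ (j * (Poly_Mapping.lookup b v + 1)))"
      unfolding I_def by (rule prod_sum_PiE[symmetric]) auto
    also have "\<dots> = (\<Prod>v\<in>T. if k v dvd Poly_Mapping.lookup b v + 1 then of_nat (k v) else 0)"
      unfolding w_def sum_roots_of_unity[OF kpos] ..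
    also have "\<dots> = (if b = a then P else 0)"
    proof (cases "\<forall>v\<in>T. k v dvd Poly_Mapping.lookup b v + 1")
      case True
      have sums: "(\<Sum>v\<in>S. Poly_Mapping.lookup b v) = (\<Sum>v\<in>S. Poly_Mapping.lookup a v)"
        using mdeg_superset[of S b] mdeg_superset[of S a] b d by (simp add: S_def)
      have ge: "Poly_Mapping.lookup b v \<ge> Poly_Mapping.lookup a v" if "v \<in> T" for v
        using True that dvd_imp_le[of "k v" "Poly_Mapping.lookup b v + 1"] by (auto simp: k_def)
      have eqT: "Poly_Mapping.lookup b v = Poly_Mapping.lookup a v" if v: "v \<in> T" for v
      proof (rule ccontr)
        assume ne: "Poly_Mapping.lookup b v \<noteq> Poly_Mapping.lookup a v"
        obtain q where q: "Poly_Mapping.lookup b v + 1 = k v * q" using True v by (auto elim: dvdE)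
        have "q \<noteq> 0" using q by (intro notI) simp
        moreover have "q \<noteq> 1" using q ne by (auto simp: k_def)
        ultimately have "2 \<le> q" by simp
        then have "k v * 2 \<le> Poly_Mapping.lookup b v + 1" unfolding q by (rule mult_le_mono2)
        moreover have "Poly_Mapping.lookup a u \<le> Poly_Mapping.lookup a v"
          using min v by (auto simp: T_def S_def)
        ultimately have "Poly_Mapping.lookup a v + Poly_Mapping.lookup a u < Poly_Mapping.lookup b v"
          by (simp add: k_def)
        moreover have "(\<Sum>v\<in>T - {v}. Poly_Mapping.lookup a v) \<le> (\<Sum>v\<in>T - {v}. Poly_Mapping.lookup b v)"
          by (rule sum_mono) (use ge in auto)
        ultimately show False
          using sums S v by (simp add: sum.remove[of T v])
      qed
      have "Poly_Mapping.lookup b u = Poly_Mapping.lookup a u"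
        using sums S eqT by simp
      have "b = a"
      proof (rule poly_mapping_eqI)
        fix v
        consider "v \<in> T" | "v = u" | "v \<notin> S" using S by blast
        then show "Poly_Mapping.lookup b v = Poly_Mapping.lookup a v"
        proof cases
          case 3
          then have "v \<notin> Poly_Mapping.keys b" "v \<notin> Poly_Mapping.keys a" using b(1) by (auto simp: S_def)
          then show ?thesis by (simp add: in_keys_iff)
        qed (use eqT \<open>Poly_Mapping.lookup b u = Poly_Mapping.lookup a u\<close> in auto)
      qed
      then show ?thesis using True by (simp add: P_def)
    next
      case False
      then have "b \<noteq> a" by (auto simp: k_def)
      moreover have "(\<Prod>v\<in>T. if k v dvd Poly_Mapping.lookup b v + 1 then complex_of_nat (k v) else 0) = 0"
        using False by (intro prod_zero) auto
      ultimately show ?thesis by simp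
    qed
    finally show ?thesis .
  qed
  define W where "W = {..<d} \<rightarrow>\<^sub>E S"
  have [simp]: "finite W" by (simp add: W_def finite_PiE)
  define N where "N = card {f\<in>W. word_monom d f = a}"
  have "N > 0"
  proof -
    from word_monom_surj[OF d] obtain f where "f \<in> W" "word_monom d f = a"
      unfolding W_def S_def ..
    then have "f \<in> {f\<in>W. word_monom d f = a}" by simp
    then have "{f\<in>W. word_monom d f = a} \<noteq> {}" by (rule ex_in_conv[THEN iffD1, OF exI])
    then show ?thesis unfolding N_def by (simp only: card_gt_0_iff) simp
  qed
  have W: "Poly_Mapping.keys (word_monom d f) \<subseteq> S" if "f \<in> W" for f
    using that by (intro keys_word_monom) (auto simp: W_def)
  have "(\<Sum>e\<in>I. Poly_Mapping.single 0 (c e) * linform S (z e) ^ d) =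
      (\<Sum>e\<in>I. \<Sum>f\<in>W. Poly_Mapping.single (word_monom d f) (c e * eval_monom (word_monom d f) (z e)))"
    by (simp add: linform_power W_def sum_distrib_left mult_single)
  also have "\<dots> = (\<Sum>f\<in>W. \<Sum>e\<in>I. Poly_Mapping.single (word_monom d f) (c e * eval_monom (word_monom d f) (z e)))"
    by (rule sum.swap)
  also have "\<dots> = (\<Sum>f\<in>W. Poly_Mapping.single (word_monom d f) (\<Sum>e\<in>I. c e * eval_monom (word_monom d f) (z e)))"
  proof (rule sum.cong[OF refl])
    fix f
    show "(\<Sum>e\<in>I. Poly_Mapping.single (word_monom d f) (c e * eval_monom (word_monom d f) (z e))) =
      Poly_Mapping.single (word_monom d f) (\<Sum>e\<in>I. c e * eval_monom (word_monom d f) (z e))"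
      using \<open>finite I\<close> by (induction I rule: finite_induct) (auto simp: single_add)
  qed
  also have "\<dots> = (\<Sum>f\<in>W. if word_monom d f = a then Poly_Mapping.single a P else 0)"
    by (rule sum.cong[OF refl]) (simp add: coeff W)
  also have "\<dots> = (\<Sum>f\<in>{f\<in>W. word_monom d f = a}. Poly_Mapping.single a P)"
    by (rule sum.inter_filter[symmetric]) simp
  also have "\<dots> = Poly_Mapping.single a (of_nat N * P)"
    unfolding N_def by (simp add: mult_single flip: single_of_nat)
  finally have main: "(\<Sum>e\<in>I. Poly_Mapping.single 0 (c e) * linform S (z e) ^ d) = Poly_Mapping.single a (of_nat N * P)" .
  have NP: "of_nat N * P \<noteq> 0" using \<open>N > 0\<close> kpos by (simp add: P_def)
  have "Poly_Mapping.single a 1 = Poly_Mapping.single 0 (1 / (of_nat N * P)) * Poly_Mapping.single a (of_nat N * P)"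
    using NP by (simp add: mult_single)
  also have "\<dots> = (\<Sum>e\<in>I. Poly_Mapping.single 0 (c e / (of_nat N * P)) * linform S (z e) ^ d)"
    unfolding main[symmetric] by (simp add: sum_distrib_left mult_single flip: mult.assoc)
  finally have eq: "Poly_Mapping.single a 1 = (\<Sum>e\<in>I. Poly_Mapping.single 0 (c e / (of_nat N * P)) * linform S (z e) ^ d)" .
  have "power_sum n d (card I) (Poly_Mapping.single a 1)"
    unfolding eq by (rule power_sumI) (use linform_in_forms[OF keys] \<open>d > 0\<close> in \<open>simp_all add: S_def\<close>)
  then show ?thesis by (simp add: cardI T_def S_def k_def)
qed

section \<open>The number of monomials\<close>

definition monoms :: "nat \<Rightarrow> nat \<Rightarrow> nat monom set" where
  "monoms n d = {m. Poly_Mapping.keys m \<subseteq> {1..n} \<and> mdeg m = d}"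

lemma bij_betw_monoms:
  "bij_betw (\<lambda>m. map (\<lambda>i. Poly_Mapping.lookup m (Suc i)) [0..<n])
     (monoms n d) {l. length l = n \<and> sum_list l = d}"
proof (rule bij_betw_byWitness[where f' = "\<lambda>l. \<Sum>i<n. Poly_Mapping.single (Suc i) (l ! i)"])
  have lookup: "Poly_Mapping.lookup (\<Sum>i<n. Poly_Mapping.single (Suc i) (l ! i)) v =
      (if v \<in> {1..n} then l ! (v - 1) else 0)" for l :: "nat list" and v
  proof (cases v)
    case (Suc j)
    then show ?thesis by (simp add: lookup_sum lookup_single when_def)
  qed (simp add: lookup_sum lookup_single when_def)
  have "mdeg m = (\<Sum>i<n. Poly_Mapping.lookup m (Suc i))" if "Poly_Mapping.keys m \<subseteq> {1..n}" for m
  proof -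
    have "mdeg m = (\<Sum>v\<in>{1..n}. Poly_Mapping.lookup m v)" using that by (intro mdeg_superset) auto
    also have "\<dots> = (\<Sum>v\<in>Suc ` {..<n}. Poly_Mapping.lookup m v)"
      by (simp add: image_Suc_lessThan)
    finally show ?thesis by (simp add: sum.reindex)
  qed
  note mdeg = this
  show "\<forall>m\<in>monoms n d. (\<Sum>i<n. Poly_Mapping.single (Suc i) (map (\<lambda>i. Poly_Mapping.lookup m (Suc i)) [0..<n] ! i)) = m"
  proof
    fix m assume "m \<in> monoms n d"
    then have "Poly_Mapping.keys m \<subseteq> {1..n}" by (simp add: monoms_def)
    then show "(\<Sum>i<n. Poly_Mapping.single (Suc i) (map (\<lambda>i. Poly_Mapping.lookup m (Suc i)) [0..<n] ! i)) = m"
      by (intro poly_mapping_eqI, subst lookup) (auto simp: in_keys_iff)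
  qed
  show "\<forall>l\<in>{l. length l = n \<and> sum_list l = d}.
      map (\<lambda>i. Poly_Mapping.lookup (\<Sum>i<n. Poly_Mapping.single (Suc i) (l ! i)) (Suc i)) [0..<n] = l"
    by (auto simp: lookup intro!: nth_equalityI)
  show "(\<lambda>m. map (\<lambda>i. Poly_Mapping.lookup m (Suc i)) [0..<n]) ` monoms n d \<subseteq> {l. length l = n \<and> sum_list l = d}"
  proof (intro image_subsetI)
    fix m assume "m \<in> monoms n d"
    then show "map (\<lambda>i. Poly_Mapping.lookup m (Suc i)) [0..<n] \<in> {l. length l = n \<and> sum_list l = d}"
      using mdeg[of m] by (simp add: monoms_def interv_sum_list_conv_sum_set_nat atLeast0LessThan)
  qed
  show "(\<lambda>l. \<Sum>i<n. Poly_Mapping.single (Suc i) (l ! i)) ` {l. length l = n \<and> sum_list l = d} \<subseteq> monoms n d"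
  proof (intro image_subsetI)
    fix l :: "nat list" assume l: "l \<in> {l. length l = n \<and> sum_list l = d}"
    let ?m = "\<Sum>i<n. Poly_Mapping.single (Suc i) (l ! i)"
    have k: "Poly_Mapping.keys ?m \<subseteq> {1..n}"
    proof
      fix v assume "v \<in> Poly_Mapping.keys ?m"
      then have "Poly_Mapping.lookup ?m v \<noteq> 0" by (simp add: in_keys_iff)
      then show "v \<in> {1..n}" unfolding lookup by (simp split: if_splits)
    qed
    have "mdeg ?m = sum_list l"
      unfolding mdeg[OF k] lookup using l by (auto simp: sum_list_sum_nth atLeast0LessThan intro!: sum.cong)
    with k l show "?m \<in> monoms n d" by (simp add: monoms_def)
  qed
qed

lemma card_monoms: "card (monoms n d) = (d + n - 1) choose d"
  using bij_betw_same_card[OF bij_betw_monoms[of n d]] by (simp add: card_length_sum_list)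

lemma finite_monoms [simp]: "finite (monoms n d)"
proof -
  have "finite {l :: nat list. set l \<subseteq> {..d} \<and> length l = n}"
    by (rule finite_lists_length_eq) simp
  moreover have "{l :: nat list. length l = n \<and> sum_list l = d} \<subseteq> {l. set l \<subseteq> {..d} \<and> length l = n}"
    using member_le_sum_list by auto
  ultimately have "finite {l :: nat list. length l = n \<and> sum_list l = d}" by (rule finite_subset[rotated])
  then show ?thesis using bij_betw_finite[OF bij_betw_monoms[of n d]] by simp
qed

section \<open>Comparison of the two bounds\<close>

text \<open>The inequality of arithmetic and geometric means, from \<open>1 + z \<le> exp z\<close>
for \<open>z = y v / A - 1\<close>.\<close>

lemma prod_le_mean_power:
  fixes y :: "'a \<Rightarrow> real"
  assumes "finite T" "\<And>v. v \<in> T \<Longrightarrow> y v \<ge> 0" "sum y T \<le> real (card T) * A" "A > 0"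
  shows "prod y T \<le> A ^ card T"
proof -
  have "(\<Prod>v\<in>T. y v / A) \<le> (\<Prod>v\<in>T. exp (y v / A - 1))"
  proof (rule prod_mono)
    fix v assume "v \<in> T"
    then show "0 \<le> y v / A \<and> y v / A \<le> exp (y v / A - 1)"
      using assms(2)[of v] assms(4) exp_ge_add_one_self[of "y v / A - 1"] by simp
  qed
  also have "\<dots> = exp (sum y T / A - card T)"
    using assms(1) by (simp add: sum_subtractf sum_divide_distrib flip: exp_sum)
  also have "\<dots> \<le> 1" using assms(3,4) by (simp add: field_simps)
  finally show ?thesis using assms(4) by (simp add: prod_dividef prod_constant divide_le_eq)
qed

text \<open>With \<open>t = d - 1\<close> and \<open>m = n - 1\<close>, the left side bounds the
rank of monomials and the right side is the expected generic rank. For \<open>m = 3\<close> the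
difference of both sides is a positive multiple of \<open>t (t + 3) (t + 6)\<close>. When
\<open>m\<close> grows by one, the right side is multiplied by \<open>1 + t / (m + 2)\<close>, and
Bernoulli's inequality shows that the left side grows by at most that factor.\<close>

lemma mean_power_less_binomial:
  fixes t :: real
  assumes "t \<ge> 1" "m \<ge> 3"
  shows "((t + m) / m) ^ m < (\<Prod>j=1..m. t + 1 + real j) / fact (Suc m)"
  using assms(2)
proof (induction m rule: dec_induct)
  case base
  have "0 < 3 * t * (t + 3) * (t + 6)" using assms(1) by simp
  then have "24 * (t + 3) ^ 3 < 27 * ((t + 2) * (t + 3) * (t + 4))"
    by (simp add: power3_eq_cube algebra_simps)
  then have "((t + 3) / 3) ^ 3 < (t + 2) * (t + 3) * (t + 4) / 24"
    by (simp add: power_divide field_simps)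
  moreover have "(\<Prod>j=1..3. t + 1 + real j) = (t + 2) * (t + 3) * (t + 4)"
    by (simp add: numeral_3_eq_3 atLeastAtMostSuc_conv algebra_simps)
  moreover have "fact (Suc 3) = (24::real)" by (simp add: fact_numeral numeral_eq_Suc)
  ultimately show ?case by (simp only: of_nat_numeral)
next
  case (step m)
  define p where "p = real m + 1"
  have m: "real m > 0" "p > 0" using step.hyps by (auto simp: p_def)
  \<comment> \<open>The factor \<open>1 + x\<close> is the quotient of the two bases, see \<open>eq\<close>.\<close>
  define x where "x = t / (real m * (p + t))"
  have "x \<ge> 0" using assms(1) m by (simp add: x_def)
  have eq: "(t + m) / m = (1 + x) * ((t + p) / p)"
  proof -
    have "real m * (p + t) + t = (t + m) * p" by (simp add: p_def algebra_simps)
    moreover have pos: "p + t > 0" using m assms(1) by simp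
    then have "1 + x = (real m * (p + t) + t) / (real m * (p + t))"
      using m unfolding x_def add_divide_distrib by simp
    ultimately have "1 + x = ((t + m) * p) / (real m * (p + t))" by simp
    then show ?thesis using m pos by (simp add: add.commute[of t p])
  qed
  have "1 + m * x \<le> (1 + x) ^ m" using Bernoulli_inequality[of x m] \<open>x \<ge> 0\<close> by simp
  moreover have mx: "1 + m * x = (p + 2 * t) / (p + t)"
  proof -
    have "m * x = t / (p + t)" using m(1) by (simp add: x_def)
    moreover have "p + t \<noteq> 0" using m assms(1) by simp
    ultimately show ?thesis by (simp add: add_divide_eq_iff)
  qed
  ultimately have bern: "(p + 2 * t) / (p + t) \<le> (1 + x) ^ m" by simp
  have "((t + p) / p) ^ Suc m * ((p + 2 * t) / (p + t)) \<le> ((t + p) / p) ^ Suc m * (1 + x) ^ m"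
    using bern m assms(1) by (intro mult_left_mono) auto
  also have "\<dots> = ((t + p) / p) * ((t + m) / m) ^ m"
    by (simp only: eq power_mult_distrib power_Suc mult_ac)
  finally have 1: "((t + p) / p) ^ Suc m * ((p + 2 * t) / (p + t)) \<le> ((t + p) / p) * ((t + m) / m) ^ m" .
  have 2: "((t + p) / p) \<le> (p + 1 + t) / (p + 1) * ((p + 2 * t) / (p + t))"
  proof -
    have "(t + p) * ((p + 1) * (p + t)) \<le> ((p + 1 + t) * (p + 2 * t)) * p"
    proof -
      have "t * t \<le> p * (t * t)" using m by (intro mult_right_mono[of 1 p "t * t", simplified]) (auto simp: p_def)
      moreover have "p * p * t \<ge> 0" using m assms(1) by simp
      ultimately show ?thesis by (simp add: algebra_simps)
    qed
    moreover have "a / b \<le> c / e" if "a * e \<le> c * b" "b > 0" "e > 0" for a b c e :: real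
      using that by (simp add: field_simps)
    ultimately have "(t + p) / p \<le> ((p + 1 + t) * (p + 2 * t)) / ((p + 1) * (p + t))"
      using m assms(1) by simp
    then show ?thesis by simp
  qed
  let ?L = "((t + p) / p) ^ Suc m" and ?q = "(p + 2 * t) / (p + t)"
  have q: "?q > 0" using m assms(1) by simp
  have "?L * ?q \<le> ((t + p) / p) * ((t + m) / m) ^ m" by (rule 1)
  also have "\<dots> \<le> ((p + 1 + t) / (p + 1) * ?q) * ((t + m) / m) ^ m"
    using 2 m assms(1) by (intro mult_right_mono) auto
  finally have "?L * ?q \<le> ((p + 1 + t) / (p + 1) * ((t + m) / m) ^ m) * ?q"
    by (simp only: mult_ac)
  then have "?L \<le> (p + 1 + t) / (p + 1) * ((t + m) / m) ^ m"
    using q by (simp only: mult_le_cancel_right_pos)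
  also have "\<dots> < (p + 1 + t) / (p + 1) * ((\<Prod>j=1..m. t + 1 + real j) / fact (Suc m))"
    using step.IH m assms(1) by (intro mult_strict_left_mono) auto
  also have "\<dots> = (\<Prod>j=1..Suc m. t + 1 + real j) / fact (Suc (Suc m))"
    by (simp add: p_def field_simps)
  finally show ?case by (simp add: p_def add.commute)
qed

lemma mean_power_less_card_monoms:
  assumes "n \<ge> 4" "d > 1"
  shows "real n * ((real d + real n - 2) / (real n - 1)) ^ (n - 1) < real (card (monoms n d))"
proof -
  define m where "m = n - 1"
  have n: "n = Suc m" "m \<ge> 3" using assms(1) by (auto simp: m_def)
  have "card (monoms n d) = (d + m) choose m"
    using binomial_symmetric[of d "d + m"] by (simp add: card_monoms n)
  moreover have "real ((d + m) choose m) = (\<Prod>j=1..m. real d + j) / fact m"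
  proof (induction m)
    case (Suc m)
    have "real (Suc m * (Suc (d + m) choose Suc m)) = real (Suc (d + m) * ((d + m) choose m))"
      by (simp only: Suc_times_binomial)
    then have "real (Suc m) * real (Suc (d + m) choose Suc m) = real (Suc (d + m)) * real ((d + m) choose m)"
      by (simp only: of_nat_mult)
    then have "real (Suc (d + m) choose Suc m) = real (Suc (d + m)) * real ((d + m) choose m) / real (Suc m)"
      by (simp only: eq_divide_eq mult.commute) simp
    also have "\<dots> = real (Suc (d + m)) * (\<Prod>j=1..m. real d + j) / (real (Suc m) * fact m)"
      unfolding Suc by simp
    also have "\<dots> = (\<Prod>j=1..Suc m. real d + j) / fact (Suc m)"
      by (simp add: algebra_simps)
    finally show ?case by simp
  qed simp
  ultimately have "real (card (monoms n d)) = (\<Prod>j=1..m. real d + j) / fact m" by simp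
  moreover have "((real d - 1 + m) / m) ^ m < (\<Prod>j=1..m. real d + j) / fact (Suc m)"
    using mean_power_less_binomial[of "real d - 1" m] n assms(2) by simp
  ultimately have "((real d - 1 + m) / m) ^ m < real (card (monoms n d)) / real n"
    by (simp add: n mult.commute)
  moreover have "real d + real n - 2 = real d - 1 + m" "real n - 1 = m" "n - 1 = m" using n by auto
  ultimately have *: "((real d + real n - 2) / (real n - 1)) ^ (n - 1) < real (card (monoms n d)) / real n"
    by (simp only:)
  have "real n > 0" using n by simp
  with * show ?thesis by (simp add: less_divide_eq mult.commute)
qed

text \<open>The rank bound is a product over the variables other than \<open>u\<close>. Absent
variables contribute the factor 1, so the product can be taken over \<open>n - 1\<close> factors
\<open>a\<^sub>v + 1\<close>, with sum \<open>d - a\<^sub>u + n - 1 \<le> d + n - 2\<close>; the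
mean inequality then applies uniformly in the number of variables that occur.\<close>

lemma power_sum_monomial_small:
  fixes a :: "nat monom"
  assumes n: "n \<ge> 4" and keys: "Poly_Mapping.keys a \<subseteq> {1..n}" and d: "mdeg a = d" "d > 1"
  shows "\<exists>r. power_sum n d r (Poly_Mapping.single a 1) \<and> n * r < card (monoms n d)"
proof -
  let ?S = "Poly_Mapping.keys a" and ?a = "Poly_Mapping.lookup a"
  have "?S \<noteq> {}" using d by auto
  then obtain u where u: "u \<in> ?S" "\<And>v. v \<in> ?S \<Longrightarrow> ?a u \<le> ?a v"
    using arg_min_if_finite[of ?S ?a] by (metis finite_keys not_less)
  define r where "r = (\<Prod>v\<in>?S - {u}. ?a v + 1)"
  have "power_sum n d r (Poly_Mapping.single a 1)"
    unfolding r_def by (rule power_sum_monomial[OF keys d(1) u])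
  moreover have "n * r < card (monoms n d)"
  proof -
    define T where "T = {1..n} - {u}"
    define A where "A = (real d + real n - 2) / (real n - 1)"
    have un: "u \<in> {1..n}" using u(1) keys by auto
    then have T: "finite T" "card T = n - 1" by (auto simp: T_def)
    have "r = (\<Prod>v\<in>T. ?a v + 1)"
      unfolding r_def by (rule prod.mono_neutral_left) (use keys in \<open>auto simp: T_def in_keys_iff\<close>)
    then have "real r = (\<Prod>v\<in>T. real (?a v) + 1)" by (simp add: add.commute)
    also have "\<dots> \<le> A ^ card T"
    proof (rule prod_le_mean_power)
      have "d = (\<Sum>v\<in>{1..n}. ?a v)" using d(1) mdeg_superset[of "{1..n}" a] keys by simp
      also have "\<dots> = ?a u + (\<Sum>v\<in>T. ?a v)" unfolding T_def using un by (simp add: sum.remove)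
      finally have "(\<Sum>v\<in>T. ?a v) + 1 \<le> d" using u(1) by (simp add: in_keys_iff)
      then have "(\<Sum>v\<in>T. real (?a v)) + 1 \<le> d" by (simp flip: of_nat_sum)
      then show "(\<Sum>v\<in>T. real (?a v) + 1) \<le> real (card T) * A"
        using n by (simp add: sum.distrib T A_def of_nat_diff)
      show "A > 0" using n d(2) by (simp add: A_def)
    qed (use T in auto)
    finally have "real r \<le> A ^ (n - 1)" by (simp add: T)
    then have "real n * real r \<le> real n * A ^ (n - 1)" by (intro mult_left_mono) auto
    also have "\<dots> < real (card (monoms n d))"
      unfolding A_def by (rule mean_power_less_card_monoms[OF n d(2)])
    finally show ?thesis by (simp flip: of_nat_mult)
  qed
  ultimately show ?thesis by blast
qed

section \<open>The locus of sums of powers\<close>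

text \<open>The identification of coefficient vectors with forms. Coordinates outside \<open>monoms
n d\<close> are ignored.\<close>

definition form_of :: "nat \<Rightarrow> nat \<Rightarrow> (nat monom \<Rightarrow> complex) \<Rightarrow> nat cpoly" where
  "form_of n d y = (\<Sum>m\<in>monoms n d. Poly_Mapping.single m (y m))"

lemma lookup_form_of: "Poly_Mapping.lookup (form_of n d y) m = (if m \<in> monoms n d then y m else 0)"
  by (simp add: form_of_def lookup_sum lookup_single when_def)

lemma lookup_outside_monoms: "F \<in> forms n d \<Longrightarrow> m \<notin> monoms n d \<Longrightarrow> Poly_Mapping.lookup F m = 0"
  by (auto simp: forms_def monoms_def in_keys_iff)

lemma form_of_in_forms: "form_of n d y \<in> forms n d"
  unfolding forms_def
proof (intro CollectI ballI)
  fix m assume "m \<in> Poly_Mapping.keys (form_of n d y)"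
  then have "m \<in> monoms n d" by (simp add: in_keys_iff lookup_form_of split: if_splits)
  then show "Poly_Mapping.keys m \<subseteq> {1..n} \<and> mdeg m = d" by (simp add: monoms_def)
qed

lemma form_of_lookup: "F \<in> forms n d \<Longrightarrow> form_of n d (Poly_Mapping.lookup F) = F"
  by (rule poly_mapping_eqI) (simp add: lookup_form_of lookup_outside_monoms)

lemma form_of_cong: "(\<And>m. m \<in> monoms n d \<Longrightarrow> y m = y' m) \<Longrightarrow> form_of n d y = form_of n d y'"
  unfolding form_of_def by (rule sum.cong) auto

lemma power_sum_scale:
  assumes "power_sum n d r F" "d > 0"
  shows "power_sum n d r (Poly_Mapping.single 0 c * F)"
proof -
  obtain l where l: "\<forall>i<r. l i \<in> forms n 1" "F = (\<Sum>i<r. l i ^ d)"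
    using assms(1) unfolding power_sum_def by blast
  have "power_sum n d (card {..<r}) (\<Sum>i<r. Poly_Mapping.single 0 c * l i ^ d)"
    by (rule power_sumI) (use l(1) assms(2) in auto)
  then show ?thesis by (simp add: l(2) sum_distrib_left)
qed

text \<open>Monomials have finite rank and span the forms, so one number of powers serves all
forms.\<close>

lemma power_sum_all_forms:
  assumes "d > 0"
  shows "\<exists>R. \<forall>y. power_sum n d R (form_of n d y)"
proof -
  have "\<exists>r. power_sum n d r (Poly_Mapping.single m 1)" if "m \<in> monoms n d" for m
  proof -
    have m: "Poly_Mapping.keys m \<subseteq> {1..n}" "mdeg m = d" using that by (auto simp: monoms_def)
    have "m \<noteq> 0" using m(2) assms by auto
    then have "Poly_Mapping.keys m \<noteq> {}" by simp
    then obtain u where "u \<in> Poly_Mapping.keys m"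
        "\<And>v. v \<in> Poly_Mapping.keys m \<Longrightarrow> Poly_Mapping.lookup m u \<le> Poly_Mapping.lookup m v"
      using arg_min_if_finite[of "Poly_Mapping.keys m" "Poly_Mapping.lookup m"] by (metis finite_keys not_less)
    from power_sum_monomial[OF m this] show ?thesis by blast
  qed
  then have "\<forall>m\<in>monoms n d. \<exists>r. power_sum n d r (Poly_Mapping.single m 1)" by blast
  from bchoice[OF this] obtain r where r: "\<And>m. m \<in> monoms n d \<Longrightarrow> power_sum n d (r m) (Poly_Mapping.single m 1)"
    by blast
  have "power_sum n d (\<Sum>m\<in>A. r m) (\<Sum>m\<in>A. Poly_Mapping.single m (y m))" if "A \<subseteq> monoms n d" for A y
    using finite_subset[OF that finite_monoms] that
  proof (induction A rule: finite_induct)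
    case empty
    show ?case by (simp add: power_sum_def)
  next
    case (insert m A)
    have "power_sum n d (r m) (Poly_Mapping.single m (y m))"
      using power_sum_scale[OF r assms, of m "y m"] insert.prems by (simp add: mult_single)
    with insert show ?case by (simp add: power_sum_add)
  qed
  then show ?thesis unfolding form_of_def by blast
qed

text \<open>Left: the coefficients of the form. Right: the parameters, with \<open>Inr (i,
v)\<close> the coefficient of \<open>x\<^sub>v\<close> in the linear form number
\<open>i\<close>.\<close>

type_synonym power_sum_var = "nat monom + nat \<times> nat"

definition power_sum_coeff :: "nat \<Rightarrow> nat \<Rightarrow> nat \<Rightarrow> nat monom \<Rightarrow> (power_sum_var \<Rightarrow> complex) \<Rightarrow> complex" where
  "power_sum_coeff n d r m x = (\<Sum>i<r. \<Sum>f\<in>{..<d} \<rightarrow>\<^sub>E {1..n}.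
     if word_monom d f = m then \<Prod>j<d. x (Inr (i, f j)) else 0)"

lemma lookup_power_sum:
  "Poly_Mapping.lookup (\<Sum>i<r. linform {1..n} (\<lambda>v. x (Inr (i, v))) ^ d) m = power_sum_coeff n d r m x"
  by (simp add: linform_power power_sum_coeff_def lookup_sum lookup_single eval_word_monom when_def)

lemma power_sum_coeff_outside: "m \<notin> monoms n d \<Longrightarrow> power_sum_coeff n d r m x = 0"
proof -
  assume m: "m \<notin> monoms n d"
  have "word_monom d f \<noteq> m" if "f \<in> {..<d} \<rightarrow>\<^sub>E {1..n}" for f
    using m keys_word_monom[of f d "{1..n}"] that by (auto simp: monoms_def PiE_def)
  then show ?thesis unfolding power_sum_coeff_def by (intro sum.neutral ballI) simp
qed

lemma polyfun_power_sum_coeff: "polyfun (power_sum_coeff n d r m)"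
proof -
  have "polyfun (\<lambda>x. if word_monom d f = m then \<Prod>j<d. x (Inr (i, f j)) else 0)" for f i
    by (cases "word_monom d f = m") (simp_all add: polyfun_prod polyfun.var polyfun.const)
  then show ?thesis unfolding power_sum_coeff_def[abs_def] by (intro polyfun_sum)
qed

lemma degree_power_sum_coeff: "degree_in_le v d (power_sum_coeff n d r m)"
proof -
  have "degree_in_le v (card {..<d} * 1) (\<lambda>x. \<Prod>j<d. x (Inr (i, f j)))" for f and i :: nat
    by (intro degree_in_le_prod degree_in_le_var) simp
  then have "degree_in_le v d (\<lambda>x. if word_monom d f = m then \<Prod>j<d. x (Inr (i, f j)) else 0)" for f i
    by (cases "word_monom d f = m") (simp_all add: degree_in_le_const)
  then show ?thesis unfolding power_sum_coeff_def[abs_def] by (intro degree_in_le_sum)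
qed

definition power_sum_params :: "nat \<Rightarrow> nat \<Rightarrow> power_sum_var set" where
  "power_sum_params n r = Inr ` ({..<r} \<times> {1..n})"

lemma power_sum_coeff_cong:
  assumes "\<And>a. a \<in> power_sum_params n r \<Longrightarrow> x a = y a"
  shows "power_sum_coeff n d r m x = power_sum_coeff n d r m y"
  unfolding power_sum_coeff_def
proof (intro sum.cong refl if_cong prod.cong)
  fix i f j assume "i \<in> {..<r}" "f \<in> {..<d} \<rightarrow>\<^sub>E {1..n}" "j \<in> {..<d}"
  then show "x (Inr (i, f j)) = y (Inr (i, f j))"
    by (intro assms) (auto simp: power_sum_params_def PiE_iff)
qed

text \<open>The condition leaves the coordinates \<open>Inr\<close> free. As a cylinder in the
larger space, the set is the outcome of projecting along the parameters.\<close>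

definition power_sum_locus :: "nat \<Rightarrow> nat \<Rightarrow> nat \<Rightarrow> (power_sum_var \<Rightarrow> complex) set" where
  "power_sum_locus n d r = {x. power_sum n d r (form_of n d (\<lambda>m. x (Inl m)))}"

lemma power_sum_locus_eq_projection:
  "power_sum_locus n d r = {x. \<exists>z. override_on x z (power_sum_params n r) \<in>
     {x. \<forall>m\<in>monoms n d. x (Inl m) = power_sum_coeff n d r m x}}"
proof (intro set_eqI iffI)
  fix x assume "x \<in> power_sum_locus n d r"
  then obtain l where l: "\<forall>i<r. l i \<in> forms n 1" "form_of n d (\<lambda>m. x (Inl m)) = (\<Sum>i<r. l i ^ d)"
    unfolding power_sum_locus_def power_sum_def by blast
  have "\<forall>i\<in>{..<r}. \<exists>b. l i = linform {1..n} b"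
    using l(1) forms_1E by (metis lessThan_iff)
  from bchoice[OF this] obtain b where b: "\<And>i. i < r \<Longrightarrow> l i = linform {1..n} (b i)" by auto
  define z :: "power_sum_var \<Rightarrow> complex" where "z v = (case v of Inl m \<Rightarrow> 0 | Inr (i, v) \<Rightarrow> b i v)" for v
  let ?y = "override_on x z (power_sum_params n r)"
  have "?y (Inl m) = power_sum_coeff n d r m ?y" if m: "m \<in> monoms n d" for m
  proof -
    have "?y (Inl m) = Poly_Mapping.lookup (form_of n d (\<lambda>m. x (Inl m))) m"
      using m by (auto simp: lookup_form_of override_on_def power_sum_params_def)
    also have "\<dots> = Poly_Mapping.lookup (\<Sum>i<r. linform {1..n} (\<lambda>v. z (Inr (i, v))) ^ d) m"
      by (simp add: l(2) b z_def)
    also have "\<dots> = power_sum_coeff n d r m z" by (rule lookup_power_sum)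
    also have "\<dots> = power_sum_coeff n d r m ?y"
      by (rule power_sum_coeff_cong) simp
    finally show ?thesis .
  qed
  then show "x \<in> {x. \<exists>z. override_on x z (power_sum_params n r) \<in>
     {x. \<forall>m\<in>monoms n d. x (Inl m) = power_sum_coeff n d r m x}}" by blast
next
  fix x assume "x \<in> {x. \<exists>z. override_on x z (power_sum_params n r) \<in>
     {x. \<forall>m\<in>monoms n d. x (Inl m) = power_sum_coeff n d r m x}}"
  then obtain z where z: "\<And>m. m \<in> monoms n d \<Longrightarrow> override_on x z (power_sum_params n r) (Inl m) =
      power_sum_coeff n d r m (override_on x z (power_sum_params n r))" by blast
  let ?y = "override_on x z (power_sum_params n r)"
  have "form_of n d (\<lambda>m. x (Inl m)) = (\<Sum>i<r. linform {1..n} (\<lambda>v. ?y (Inr (i, v))) ^ d)"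
  proof (rule poly_mapping_eqI)
    fix m
    have "?y (Inl m) = x (Inl m)" by (auto simp: override_on_def power_sum_params_def)
    then show "Poly_Mapping.lookup (form_of n d (\<lambda>m. x (Inl m))) m =
        Poly_Mapping.lookup (\<Sum>i<r. linform {1..n} (\<lambda>v. ?y (Inr (i, v))) ^ d) m"
      unfolding lookup_power_sum lookup_form_of using z[of m] power_sum_coeff_outside[of m n d r ?y] by simp
  qed
  then show "x \<in> power_sum_locus n d r"
    unfolding power_sum_locus_def power_sum_def using linform_in_forms[of "{1..n}" n]
    by (intro CollectI exI[of _ "\<lambda>i. linform {1..n} (\<lambda>v. ?y (Inr (i, v)))"]) auto
qed

lemma constructible_power_sum_locus: "constructible (power_sum_locus n d r)"
  unfolding power_sum_locus_eq_projection
proof (rule constructible_project)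
  show "finite (power_sum_params n r)" by (simp add: power_sum_params_def)
  let ?P = "(\<lambda>m (x :: power_sum_var \<Rightarrow> complex). x (Inl m) - power_sum_coeff n d r m x) ` monoms n d"
  have "{x. \<forall>m\<in>monoms n d. x (Inl m) = power_sum_coeff n d r m x} = basic_set ?P (\<lambda>x. 1)"
    by (auto simp: basic_set_def)
  also have "constructible \<dots>"
  proof (rule constructible.basic)
    show "finite ?P" by simp
    show "\<forall>p\<in>?P. polyfun p"
      by (auto intro!: polyfun_diff polyfun.var polyfun_power_sum_coeff)
    show "polyfun (\<lambda>x. 1)" by (rule polyfun.const)
  qed
  finally show "constructible {x. \<forall>m\<in>monoms n d. x (Inl m) = power_sum_coeff n d r m x}" .
qed

text \<open>With \<open>n * r\<close> parameters for more than \<open>n * r\<close> coefficients,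
the coefficients of a sum of \<open>r\<close> powers satisfy an algebraic relation \<open>Q\<close>,
so such forms avoid the generic set \<open>Q \<noteq> 0\<close>.\<close>

lemma generic_power_sum_locus_imp_card_le:
  assumes "generic (power_sum_locus n d r)"
  shows "card (monoms n d) \<le> n * r"
proof (rule ccontr)
  assume "\<not> card (monoms n d) \<le> n * r"
  moreover have "card (power_sum_params n r) = n * r"
    unfolding power_sum_params_def by (subst card_image) (auto simp: inj_on_def)
  ultimately have less: "card (power_sum_params n r) < card (monoms n d)" by simp
  have fin: "finite (power_sum_params n r)" by (simp add: power_sum_params_def)
  have "\<exists>Q. polyfun Q \<and> (\<exists>y. Q y \<noteq> 0) \<and>
      (\<forall>y x. (\<forall>m\<in>monoms n d. y m = power_sum_coeff n d r m x) \<longrightarrow> Q y = 0)"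
    by (rule algebraic_relation[OF finite_monoms fin less degree_power_sum_coeff power_sum_coeff_cong])
  then obtain Q where "polyfun Q \<and> (\<exists>y. Q y \<noteq> 0) \<and>
      (\<forall>y x. (\<forall>m\<in>monoms n d. y m = power_sum_coeff n d r m x) \<longrightarrow> Q y = 0)" ..
  then have Q: "polyfun Q" "\<exists>y. Q y \<noteq> 0"
      "\<forall>y x. (\<forall>m\<in>monoms n d. y m = power_sum_coeff n d r m x) \<longrightarrow> Q y = 0"
    by blast+
  from Q(2) obtain y where y: "Q y \<noteq> 0" ..
  have "generic {x :: power_sum_var \<Rightarrow> complex. Q (\<lambda>m. x (Inl m)) \<noteq> 0}"
  proof (rule genericI[of _ "case_sum y (\<lambda>_. 0)"])
    show "polyfun (\<lambda>x :: power_sum_var \<Rightarrow> complex. Q (\<lambda>m. x (Inl m)))"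
      by (rule polyfun_comp[OF Q(1)]) (rule polyfun.var)
    show "Q (\<lambda>m. case_sum y (\<lambda>_. 0) (Inl m)) \<noteq> 0" using y by simp
  qed simp
  from generic_nonempty[OF generic_Int[OF assms this]]
  obtain x where x: "x \<in> power_sum_locus n d r" "Q (\<lambda>m. x (Inl m)) \<noteq> 0" by blast
  from x(1) obtain z where z: "\<forall>m\<in>monoms n d. override_on x z (power_sum_params n r) (Inl m) =
      power_sum_coeff n d r m (override_on x z (power_sum_params n r))"
    unfolding power_sum_locus_eq_projection by blast
  have "override_on x z (power_sum_params n r) (Inl m) = x (Inl m)" for m
    by (auto simp: override_on_def power_sum_params_def)
  with z have "\<forall>m\<in>monoms n d. x (Inl m) = power_sum_coeff n d r m (override_on x z (power_sum_params n r))"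
    by simp
  then have "Q (\<lambda>m. x (Inl m)) = 0" by (rule Q(3)[THEN spec, THEN spec, THEN mp])
  with x(2) show False by simp
qed

section \<open>The generic Waring rank\<close>

lemma openin_zariski_principal: "openin (zariski n d) {F \<in> forms n d. eval_poly P (Poly_Mapping.lookup F) \<noteq> 0}"
  unfolding openin_zariski by (rule exI[of _ "{P}"]) auto

lemma zariski_open_contains_principal:
  assumes "openin (zariski n d) U" "F \<in> U"
  obtains P where "eval_poly P (Poly_Mapping.lookup F) \<noteq> 0"
    "{G \<in> forms n d. eval_poly P (Poly_Mapping.lookup G) \<noteq> 0} \<subseteq> U"
proof -
  obtain S where S: "U = forms n d - {F \<in> forms n d. \<forall>P\<in>S. eval_poly P (Poly_Mapping.lookup F) = 0}"
    using assms(1) unfolding openin_zariski by blast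
  then obtain P where "P \<in> S" "eval_poly P (Poly_Mapping.lookup F) \<noteq> 0" using assms(2) by blast
  with S show thesis by (intro that[of P]) auto
qed

lemma zariski_irreducible:
  assumes "openin (zariski n d) U" "openin (zariski n d) V" "U \<noteq> {}" "V \<noteq> {}"
  shows "U \<inter> V \<noteq> {}"
proof -
  obtain F G where FG: "F \<in> U" "G \<in> V" using assms(3,4) by blast
  then have forms: "F \<in> forms n d" "G \<in> forms n d"
    using openin_subset[OF assms(1)] openin_subset[OF assms(2)] by auto
  obtain P where P: "eval_poly P (Poly_Mapping.lookup F) \<noteq> 0"
      "{H \<in> forms n d. eval_poly P (Poly_Mapping.lookup H) \<noteq> 0} \<subseteq> U"
    by (rule zariski_open_contains_principal[OF assms(1) FG(1)])
  obtain Q where Q: "eval_poly Q (Poly_Mapping.lookup G) \<noteq> 0"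
      "{H \<in> forms n d. eval_poly Q (Poly_Mapping.lookup H) \<noteq> 0} \<subseteq> V"
    by (rule zariski_open_contains_principal[OF assms(2) FG(2)])
  have "polyfun (\<lambda>y. Poly_Mapping.lookup (form_of n d y) m)" for m
    by (cases "m \<in> monoms n d") (simp_all add: lookup_form_of polyfun.var polyfun.const)
  then have pf: "polyfun (\<lambda>y. eval_poly R (Poly_Mapping.lookup (form_of n d y)))" for R
    by (rule polyfun_comp[OF polyfun_eval_poly])
  have "\<exists>y. eval_poly P (Poly_Mapping.lookup (form_of n d y)) * eval_poly Q (Poly_Mapping.lookup (form_of n d y)) \<noteq> 0"
    by (rule polyfun_common_nonzero[OF pf pf, of P "Poly_Mapping.lookup F" Q "Poly_Mapping.lookup G"])
       (use P(1) Q(1) forms in \<open>simp_all add: form_of_lookup\<close>)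
  then obtain y where "eval_poly P (Poly_Mapping.lookup (form_of n d y)) \<noteq> 0"
      "eval_poly Q (Poly_Mapping.lookup (form_of n d y)) \<noteq> 0" by auto
  then show ?thesis using P(2) Q(2) form_of_in_forms by blast
qed

lemma zariski_open_dense:
  assumes "openin (zariski n d) U" "U \<noteq> {}"
  shows "zariski n d closure_of U = topspace (zariski n d)"
  unfolding dense_intersects_open using zariski_irreducible[OF assms(1) _ assms(2)] by blast

text \<open>Passing from generic sets of assignments to open sets of forms: the variables that are
not coefficients of a form of degree \<open>d\<close> are frozen at their values in a point
\<open>x0\<close> where \<open>p\<close> does not vanish, which turns \<open>p\<close> into a
polynomial in the coefficients that is still not zero.\<close>

lemma generic_imp_zariski_open:
  fixes S :: "(power_sum_var \<Rightarrow> complex) set"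
  assumes "generic S"
  shows "\<exists>U. openin (zariski n d) U \<and> U \<noteq> {} \<and>
    (\<forall>F\<in>U. \<exists>x\<in>S. F = form_of n d (\<lambda>m. x (Inl m)))"
proof -
  obtain p x0 where p: "polyfun p" "p x0 \<noteq> 0" "{x. p x \<noteq> 0} \<subseteq> S" using assms by (rule genericE)
  define ext :: "(nat monom \<Rightarrow> complex) \<Rightarrow> power_sum_var \<Rightarrow> complex"
    where "ext y v = (case v of Inl m \<Rightarrow> if m \<in> monoms n d then y m else x0 v | Inr q \<Rightarrow> x0 v)" for y v
  have "polyfun (\<lambda>y. ext y v)" for v
  proof (cases v)
    case (Inl m)
    then show ?thesis
      by (cases "m \<in> monoms n d") (simp_all add: ext_def polyfun.var polyfun.const)
  qed (simp add: ext_def polyfun.const)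
  then have "polyfun (\<lambda>y. p (ext y))" by (rule polyfun_comp[OF p(1)])
  from polyfun_imp_eval_poly[OF this] obtain P where P: "\<forall>y. p (ext y) = eval_poly P y" ..
  define U where "U = {F \<in> forms n d. eval_poly P (Poly_Mapping.lookup F) \<noteq> 0}"
  have "openin (zariski n d) U" unfolding U_def by (rule openin_zariski_principal)
  moreover have "form_of n d (\<lambda>m. x0 (Inl m)) \<in> U"
  proof -
    have "ext (Poly_Mapping.lookup (form_of n d (\<lambda>m. x0 (Inl m)))) = x0"
      by (rule ext) (auto simp: ext_def lookup_form_of split: sum.split)
    then show ?thesis unfolding U_def using p(2) P form_of_in_forms by (metis (mono_tags) mem_Collect_eq)
  qed
  moreover have "\<exists>x\<in>S. F = form_of n d (\<lambda>m. x (Inl m))" if "F \<in> U" for F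
  proof (rule bexI)
    show "ext (Poly_Mapping.lookup F) \<in> S" using that P p(3) by (auto simp: U_def)
    have "form_of n d (\<lambda>m. ext (Poly_Mapping.lookup F) (Inl m)) = form_of n d (Poly_Mapping.lookup F)"
      by (rule form_of_cong) (simp add: ext_def)
    then show "F = form_of n d (\<lambda>m. ext (Poly_Mapping.lookup F) (Inl m))"
      using that form_of_lookup by (simp add: U_def)
  qed
  ultimately show ?thesis by blast
qed

text \<open>A nonempty open set is dense, and two dense open sets meet, so the value of the rank on
either is the same.\<close>

lemma generic_waring_rank_eqI:
  assumes "openin (zariski n d) U" "U \<noteq> {}" "\<And>F. F \<in> U \<Longrightarrow> waring_rank n d F = r"
  shows "generic_waring_rank n d = r"
  unfolding generic_waring_rank_def
proof (rule the_equality)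
  show "\<exists>U. openin (zariski n d) U \<and> zariski n d closure_of U = topspace (zariski n d) \<and>
      (\<forall>F\<in>U. waring_rank n d F = r)"
    using assms zariski_open_dense[OF assms(1,2)] by blast
next
  fix r' assume "\<exists>U. openin (zariski n d) U \<and> zariski n d closure_of U = topspace (zariski n d) \<and>
      (\<forall>F\<in>U. waring_rank n d F = r')"
  then obtain V where V: "zariski n d closure_of V = topspace (zariski n d)"
      "\<forall>F\<in>V. waring_rank n d F = r'" by blast
  then have "V \<inter> U \<noteq> {}" using assms(1,2) unfolding dense_intersects_open by blast
  then obtain F where "F \<in> V" "F \<in> U" by blast
  then show "r' = r" using V(2) assms(3)[of F] by simp
qed

text \<open>Let \<open>r\<close> be least such that sums of \<open>r\<close> powers are generic. By
the dichotomy for constructible sets, generic forms are not sums of \<open>r - 1\<close> powers. So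
\<open>r\<close> is the generic rank, and the parameter count applies to it.\<close>

lemma card_monoms_le_generic_waring_rank:
  assumes "d > 0"
  shows "card (monoms n d) \<le> n * generic_waring_rank n d"
proof -
  obtain R where "\<forall>y. power_sum n d R (form_of n d y)" using power_sum_all_forms[OF assms] ..
  then have "power_sum_locus n d R = UNIV" by (auto simp: power_sum_locus_def)
  then have R: "generic (power_sum_locus n d R)" by (simp add: generic_UNIV)
  define r where "r = (LEAST r. generic (power_sum_locus n d r))"
  have r: "generic (power_sum_locus n d r)" unfolding r_def by (rule LeastI[of _ R]) (rule R)
  define S where "S = power_sum_locus n d r - (\<Union>s<r. power_sum_locus n d s)"
  have "generic S"
  proof (cases r)
    case 0
    then show ?thesis using r by (simp add: S_def)
  next
    case (Suc r')
    have "\<not> generic (power_sum_locus n d r')"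
      using not_less_Least[of r' "\<lambda>r. generic (power_sum_locus n d r)"] Suc by (simp flip: r_def)
    then have "generic (- power_sum_locus n d r')"
      using constructible_generic_or_cogeneric[OF constructible_power_sum_locus] by blast
    from generic_Int[OF r this] show ?thesis
    proof (rule generic_mono)
      have "power_sum_locus n d s \<subseteq> power_sum_locus n d r'" if "s < r" for s
        using power_sum_mono[of n d s _ r'] that Suc assms by (auto simp: power_sum_locus_def)
      then show "power_sum_locus n d r \<inter> - power_sum_locus n d r' \<subseteq> S" by (auto simp: S_def)
    qed
  qed
  from generic_imp_zariski_open[OF this] obtain U where "openin (zariski n d) U \<and> U \<noteq> {} \<and>
      (\<forall>F\<in>U. \<exists>x\<in>S. F = form_of n d (\<lambda>m. x (Inl m)))" ..
  then have U: "openin (zariski n d) U" "U \<noteq> {}"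
      "\<And>F. F \<in> U \<Longrightarrow> \<exists>x\<in>S. F = form_of n d (\<lambda>m. x (Inl m))" by simp_all
  have "waring_rank n d F = r" if "F \<in> U" for F
  proof -
    obtain x where "x \<in> S" "F = form_of n d (\<lambda>m. x (Inl m))" using U(3)[OF \<open>F \<in> U\<close>] ..
    then have "power_sum n d r F" "\<forall>s<r. \<not> power_sum n d s F"
      by (auto simp: S_def power_sum_locus_def)
    then show ?thesis unfolding waring_rank_eq[OF assms]
      by (intro Least_equality) (auto simp: not_less[symmetric])
  qed
  then have "generic_waring_rank n d = r" by (rule generic_waring_rank_eqI[OF U(1,2)])
  then show ?thesis using generic_power_sum_locus_imp_card_le[OF r] by simp
qed

theorem theorem1:
  fixes n d :: nat and a :: "nat monom" and M :: "nat cpoly"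
  assumes "n \<ge> 4"
    and "Poly_Mapping.keys a \<subseteq> {1..n}"
    and "M = Poly_Mapping.single a 1"
    and "d = mdeg a"
    and "d > 1"
  shows "waring_rank n d M < generic_waring_rank n d"
proof -
  obtain r where r: "power_sum n d r M" "n * r < card (monoms n d)"
    using power_sum_monomial_small[of n a d] assms by auto
  have "waring_rank n d M \<le> r"
    using r(1) assms(5) by (simp add: waring_rank_eq Least_le)
  moreover have "n * r < n * generic_waring_rank n d"
    using r(2) card_monoms_le_generic_waring_rank[of d n] assms(5) by linarith
  ultimately show ?thesis by simp
qed

end
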